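(* Let $\underline{x} = (x_1,x_2)^T\in \mathbb{F}_q((T^{-1}))^2$ with $x_2\neq 0$ and $x_1/x_2 \notin \mathbb{F}_q(T)$, and let $y \in \mathbb{F}_q((T^{-1}))\setminus \mathbb{F}_q(T)$ satisfy $\omega(y) = 1$. Then for almost every point $\underline{y}$ of the line $\{ t\,(y,1)^T : t \in \mathbb{F}_q((T^{-1}))\}$ one has \[ \mu(\underline{x}, \underline{y}) \leq \frac{1}{2}. \]
   Context: $\mathbb{F}_q((T^{-1}))$ is the field of formal Laurent series in $T^{-1}$ over the finite field $\mathbb{F}_q$ with absolute value $|x|=q^{\deg x}$ ($|0|=0$); $\|x\|$ is the distance from $x$ to the nearest polynomial in $\mathbb{F}_q[T]$. For vectors and matrices, $|\cdot|$ is the max of absolute values of entries. "Almost every" refers to the Haar measure on $\mathbb{F}_q((T^{-1}))$ transported to the line via $t\mapsto t(y,1)^T$. $\omega(y)$ is the supremum of real $\omega$ such that for arbitrarily large $H$ there is $Q\in\mathbb{F}_q[T]\setminus\{0\}$ with $|Q|\le H$ and $\|Qy\|\le H^{-\omega}$. $\mu(\underline{x},\underline{y})$ is the supremum of $\mu$ such that $|\gamma\underline{x}-\underline{y}|\le|\gamma|^{-\mu}$ holds for infinitely many $\gamma\in\mathrm{SL}_2(\mathbb{F}_q[T])$ (acting on column vectors by multiplication). *)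

theory Defs
  imports "HOL-Analysis.Analysis" "HOL-Computational_Algebra.Formal_Laurent_Series"
begin

text \<open>
  The field of Laurent series in \<open>T\<^sup>-\<^sup>1\<close> over the finite field \<^typ>\<open>'a\<close> is \<^typ>\<open>'a fls\<close>, where
  \<^const>\<open>fls_X\<close> plays the role of \<open>T\<^sup>-\<^sup>1\<close> and \<^const>\<open>fls_X_inv\<close> that of \<open>T\<close>;
  hence \<open>deg x = - fls_subdegree x\<close>.
\<close>

definition fls_abs :: "'a::{field,finite} fls \<Rightarrow> real" where
  "fls_abs x = (if x = 0 then 0 else real CARD('a) powi (- fls_subdegree x))"

definition polyT :: "'a::{field,finite} poly \<Rightarrow> 'a fls" where
  "polyT p = poly (map_poly fls_const p) fls_X_inv"

definition ratT :: "'a::{field,finite} fls set" where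
  "ratT = {polyT p / polyT q | p q. q \<noteq> 0}"

definition dist_polyT :: "'a::{field,finite} fls \<Rightarrow> real" where
  "dist_polyT x = (INF p. fls_abs (x - polyT p))"

definition omega_exp :: "'a::{field,finite} fls \<Rightarrow> ereal" where
  "omega_exp y = Sup {ereal w | w. \<exists>\<^sub>F H in at_top. \<exists>Q. Q \<noteq> 0 \<and>
     fls_abs (polyT Q) \<le> H \<and> dist_polyT (polyT Q * y) \<le> H powr (- w)}"

definition vec_abs :: "'a::{field,finite} fls ^ 'n \<Rightarrow> real" where
  "vec_abs v = Max (range (\<lambda>i. fls_abs (v $ i)))"

definition mat_abs :: "'a::{field,finite} fls ^ 'n ^ 'm \<Rightarrow> real" where
  "mat_abs A = Max (range (\<lambda>(i, j). fls_abs (A $ i $ j)))"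

definition SL2_poly :: "('a::{field,finite} poly ^ 2 ^ 2) set" where
  "SL2_poly = {\<gamma>. det \<gamma> = 1}"

definition mat_polyT :: "'a::{field,finite} poly ^ 'n ^ 'm \<Rightarrow> 'a fls ^ 'n ^ 'm" where
  "mat_polyT \<gamma> = (\<chi> i j. polyT (\<gamma> $ i $ j))"

definition mu_exp :: "'a::{field,finite} fls ^ 2 \<Rightarrow> 'a fls ^ 2 \<Rightarrow> ereal" where
  "mu_exp x y = Sup {ereal m | m. infinite {\<gamma> \<in> SL2_poly.
     vec_abs (mat_polyT \<gamma> *v x - y) \<le> mat_abs (mat_polyT \<gamma>) powr (- m)}}"

text \<open>
  The library metric on \<^typ>\<open>'a fls\<close> is based on powers of 2 rather than of \<open>CARD('a)\<close>, but it
  induces the same topology as \<open>fls_abs\<close>. This group being locally compact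
  and second countable, regularity follows from finiteness on compact sets. A Haar measure is
  unique up to a positive factor, so its null sets do not depend on the choice.
\<close>

definition haar_measure_fls :: "'a::{field,finite} fls measure \<Rightarrow> bool" where
  "haar_measure_fls M \<longleftrightarrow> sets M = sets borel \<and>
     (\<forall>A \<in> sets borel. \<forall>a. emeasure M ((+) a ` A) = emeasure M A) \<and>
     (\<forall>K. compact K \<longrightarrow> emeasure M K < \<infinity>) \<and>
     emeasure M UNIV \<noteq> 0"

text \<open>
  Haar measures exist: write a nonnegative real in base \<open>q = CARD('a)\<close> and push Lebesgue measure
  forward along the map taking its digit sequence to the Laurent series with these coefficients.
\<close>

context
begin

unbundle fps_syntax

private definition digit_floor :: "int \<Rightarrow> real \<Rightarrow> int \<Rightarrow> int" where
  "digit_floor q x m = \<lfloor>x * of_int q powi m\<rfloor>"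

private lemma digit_floor_div:
  assumes "q \<ge> 2"
  shows "digit_floor q x (m + 1) div q = digit_floor q x m"
proof -
  have "x * of_int q powi m = x * of_int q powi (m + 1) / of_int q"
    using assms by (simp add: power_int_add)
  then show ?thesis
    using assms floor_divide_real_eq_div[of q "x * of_int q powi (m + 1)"]
    by (simp add: digit_floor_def)
qed

private lemma digit_floor_zero:
  assumes "q \<ge> 2" "x \<ge> 0" "digit_floor q x n = 0" "m \<le> n"
  shows "digit_floor q x m = 0"
proof -
  have "0 \<le> x * of_int q powi m" using assms by simp
  moreover have "x * of_int q powi m \<le> x * of_int q powi n"
    using assms by (intro mult_left_mono power_int_increasing) auto
  moreover have "x * of_int q powi n < 1"
    using assms(3) unfolding digit_floor_def by linarith
  ultimately show ?thesis unfolding digit_floor_def by linarith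
qed

private lemma digit_floor_small:
  assumes "q \<ge> 2" "x \<ge> 0"
  obtains N where "digit_floor q x N = 0" "N \<le> M"
proof -
  obtain k where k: "x < of_int q ^ k"
    using real_arch_pow[of "of_int q" x] assms by auto
  have "x * of_int q powi (- int k) < 1"
    using k assms by (simp add: power_int_minus field_simps)
  moreover have "0 \<le> x * of_int q powi (- int k)" using assms by simp
  ultimately have "digit_floor q x (- int k) = 0"
    unfolding digit_floor_def by linarith
  then have "digit_floor q x (min M (- int k)) = 0"
    by (rule digit_floor_zero[OF assms]) simp
  then show ?thesis by (rule that) simp
qed

private lemma digits_zero_iff:
  assumes "q \<ge> 2" "x \<ge> 0"
  shows "(\<forall>m\<le>n. digit_floor q x m mod q = 0) \<longleftrightarrow> digit_floor q x n = 0"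
proof
  assume *: "\<forall>m\<le>n. digit_floor q x m mod q = 0"
  obtain N where N: "digit_floor q x N = 0" "N \<le> n"
    using digit_floor_small[OF assms] by blast
  from N(2) * show "digit_floor q x n = 0"
  proof (induction n rule: int_ge_induct)
    case base
    then show ?case using N by simp
  next
    case (step i)
    have "digit_floor q x (i + 1) div q = 0"
      using step digit_floor_div[OF assms(1)] by simp
    moreover have "digit_floor q x (i + 1) mod q = 0" using step by simp
    ultimately show ?case
      using div_mult_mod_eq[of "digit_floor q x (i + 1)" q] by simp
  qed
qed (use digit_floor_zero[OF assms] in auto)

private lemma digits_eq_iff:
  assumes q: "q \<ge> 2" and c: "\<And>m. 0 \<le> c m" "\<And>m. c m < q" "\<And>m. m < N \<Longrightarrow> c m = 0"
  shows "\<exists>k\<ge>0. \<forall>x\<ge>0. (\<forall>m\<le>n. digit_floor q x m mod q = c m) \<longleftrightarrow> digit_floor q x n = k"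
proof (cases "n < N")
  case True
  then show ?thesis using digits_zero_iff[OF q, of _ n] c(3) by (intro exI[of _ 0]) auto
next
  case False
  then have "N - 1 \<le> n" by simp
  then show ?thesis
  proof (induction n rule: int_ge_induct)
    case base
    then show ?case using digits_zero_iff[OF q, of _ "N - 1"] c(3) by (intro exI[of _ 0]) auto
  next
    case (step i)
    then obtain k where k: "k \<ge> 0"
      "\<And>x. x \<ge> 0 \<Longrightarrow> (\<forall>m\<le>i. digit_floor q x m mod q = c m) \<longleftrightarrow> digit_floor q x i = k"
      by blast
    have "(\<forall>m\<le>i+1. digit_floor q x m mod q = c m) \<longleftrightarrow> digit_floor q x (i + 1) = k * q + c (i + 1)"
      if "x \<ge> 0" for x
    proof -
      have le: "m \<le> i + 1 \<longleftrightarrow> m \<le> i \<or> m = i + 1" for m by arith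
      have "(\<forall>m\<le>i+1. digit_floor q x m mod q = c m) \<longleftrightarrow>
          (\<forall>m\<le>i. digit_floor q x m mod q = c m) \<and> digit_floor q x (i + 1) mod q = c (i + 1)"
        unfolding le by blast
      also have "\<dots> \<longleftrightarrow> digit_floor q x (i + 1) div q = k \<and> digit_floor q x (i + 1) mod q = c (i + 1)"
        using k(2)[OF that] digit_floor_div[OF q] by simp
      also have "\<dots> \<longleftrightarrow> digit_floor q x (i + 1) = k * q + c (i + 1)"
      proof
        assume "digit_floor q x (i + 1) div q = k \<and> digit_floor q x (i + 1) mod q = c (i + 1)"
        then show "digit_floor q x (i + 1) = k * q + c (i + 1)"
          using div_mult_mod_eq[of "digit_floor q x (i + 1)" q] by metis
      next
        assume "digit_floor q x (i + 1) = k * q + c (i + 1)"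
        then show "digit_floor q x (i + 1) div q = k \<and> digit_floor q x (i + 1) mod q = c (i + 1)"
          using q c(1,2)[of "i + 1"] by simp
      qed
      finally show ?thesis .
    qed
    moreover have "k * q + c (i + 1) \<ge> 0" using k(1) q c(1) by simp
    ultimately show ?case by blast
  qed
qed

private definition cyl :: "int \<Rightarrow> 'a::{field,finite} fls \<Rightarrow> 'a fls set" where
  "cyl n a = {z. \<forall>m\<le>n. z $$ m = a $$ m}"

private lemma cyl_subdegree: "z \<in> cyl n a \<longleftrightarrow> z = a \<or> fls_subdegree (z - a) > n"
proof
  assume z: "z \<in> cyl n a"
  show "z = a \<or> fls_subdegree (z - a) > n"
  proof (rule ccontr)
    assume "\<not> ?thesis"
    then have "(z - a) $$ fls_subdegree (z - a) \<noteq> 0" "fls_subdegree (z - a) \<le> n"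
      using nth_fls_subdegree_nonzero[of "z - a"] by simp_all
    then show False using z by (simp add: cyl_def)
  qed
next
  assume *: "z = a \<or> fls_subdegree (z - a) > n"
  have "z $$ m = a $$ m" if "m \<le> n" "z \<noteq> a" for m
  proof -
    have "(z - a) $$ m = 0" using that * by (intro fls_eq0_below_subdegree) auto
    then show ?thesis by simp
  qed
  then show "z \<in> cyl n a" by (cases "z = a") (auto simp: cyl_def)
qed

private lemma dist_fls_powi:
  "dist (x :: 'a::{field,finite} fls) y = (if x = y then 0 else 2 powi (- fls_subdegree (x - y)))"
  by (auto simp: dist_fls_def power_int_def power_one_over inverse_eq_divide)

private lemma cyl_eq_ball: "cyl n a = ball a (2 powi (- n))"
proof -
  have "(2::real) powi i < 2 powi j \<longleftrightarrow> i < j" for i j :: int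
    using power_int_strict_increasing[of i j "2::real"] power_int_increasing[of j i "2::real"]
    by (force simp: not_less)
  then show ?thesis
    by (auto simp: cyl_subdegree dist_fls_powi fls_subdegree_minus_sym[of a] split: if_splits)
qed

private lemma open_cyl: "open (cyl n a)"
  by (simp add: cyl_eq_ball)

private lemma cyl_borel: "cyl n a \<in> sets borel"
  by (intro borel_open open_cyl)

private lemma cyl_self: "a \<in> cyl n a"
  by (simp add: cyl_def)

private lemma cyl_in_open:
  assumes "open U" "a \<in> U"
  obtains n where "cyl n a \<subseteq> U"
proof -
  obtain r where r: "r > 0" "ball a r \<subseteq> U" using assms openE by blast
  obtain k where "(1/2::real) ^ k < r" using real_arch_pow_inv[OF r(1), of "1/2"] by auto
  then have "(2::real) powi (- int k) < r" by (simp add: power_int_minus power_one_over field_simps)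
  then have "cyl (int k) a \<subseteq> ball a r" unfolding cyl_eq_ball by (intro subset_ball) simp
  with r that show ?thesis by blast
qed

private lemma cyl_Int:
  assumes "n \<le> m"
  shows "cyl n a \<inter> cyl m b = {} \<or> cyl n a \<inter> cyl m b = cyl m b"
  using assms unfolding cyl_def by fastforce

lemma haar_measure_fls_exists: "\<exists>M :: 'a::{field,finite} fls measure. haar_measure_fls M"
proof -
  define q where "q = int CARD('a)"
  have "card {0, 1 :: 'a} \<le> CARD('a)" by (intro card_mono) auto
  then have q2: "q \<ge> 2" by (simp add: q_def)
  obtain h :: "'a \<Rightarrow> nat" where h: "bij_betw h UNIV {0..<CARD('a)}"
    using ex_bij_betw_finite_nat[of "UNIV :: 'a set"] by auto
  define d where "d a = (int (h a) - int (h 0)) mod q" for a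
  have d_range: "0 \<le> d a" "d a < q" for a using q2 by (auto simp: d_def)
  have d0: "d 0 = 0" by (simp add: d_def)
  have "inj d"
  proof
    fix a b assume "d a = d b"
    then have "q dvd (int (h a) - int (h 0)) - (int (h b) - int (h 0))"
      unfolding d_def by (simp add: mod_eq_dvd_iff)
    then have "q dvd int (h a) - int (h b)" by simp
    moreover have "\<bar>int (h a) - int (h b)\<bar> < q"
    proof -
      have "h a < CARD('a)" "h b < CARD('a)" using bij_betwE[OF h] by auto
      then show ?thesis unfolding q_def by linarith
    qed
    ultimately have "int (h a) - int (h b) = 0"
      using zdvd_imp_le[of q "\<bar>int (h a) - int (h b)\<bar>"] by fastforce
    then show "a = b" using h by (auto simp: bij_betw_def inj_on_def)
  qed
  have "range d = {0..<q}"
  proof (rule card_subset_eq)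
    show "card (range d) = card {0..<q}" using card_image[OF \<open>inj d\<close>] by (simp add: q_def)
  qed (use d_range in auto)
  define e where "e = inv d"
  have e_eq: "e k = a \<longleftrightarrow> k = d a" if "0 \<le> k" "k < q" for k a
  proof -
    have "k \<in> range d" using that \<open>range d = _\<close> by simp
    then show ?thesis unfolding e_def using \<open>inj d\<close> by (auto simp: f_inv_into_f)
  qed
  define \<Phi> where "\<Phi> x = Abs_fls (\<lambda>m. e (digit_floor q x m mod q))" for x :: real
  have \<Phi>: "\<Phi> x $$ m = e (digit_floor q x m mod q)" if x: "x \<ge> 0" for x m
  proof -
    obtain N where N: "digit_floor q x N = 0" using digit_floor_small[OF q2 x] by blast
    have "e (digit_floor q x m mod q) = 0" if "m < N" for m
      using digit_floor_zero[OF q2 x N, of m] that e_eq[of 0 0] d0 q2 by simp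
    then show ?thesis unfolding \<Phi>_def by (intro nth_Abs_fls_lower_bound[of N]) auto
  qed
  have pre: "\<exists>k::nat. \<Phi> -` cyl n a \<inter> {0..} = {real k / of_int q powi n ..< (real k + 1) / of_int q powi n}" for n a
  proof -
    have "\<exists>k\<ge>0. \<forall>x\<ge>0. (\<forall>m\<le>n. digit_floor q x m mod q = d (a $$ m)) \<longleftrightarrow> digit_floor q x n = k"
    proof (rule digits_eq_iff[OF q2, of _ "fls_subdegree a"])
      show "d (a $$ m) = 0" if "m < fls_subdegree a" for m using that d0 by simp
    qed (use d_range in auto)
    then obtain k where k: "k \<ge> 0"
      "\<And>x. x\<ge>0 \<Longrightarrow> (\<forall>m\<le>n. digit_floor q x m mod q = d (a $$ m)) \<longleftrightarrow> digit_floor q x n = k" by blast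
    have pos: "(of_int q :: real) powi n > 0" using q2 by simp
    have "x \<in> \<Phi> -` cyl n a \<inter> {0..} \<longleftrightarrow>
        x \<in> {real (nat k) / of_int q powi n ..< (real (nat k) + 1) / of_int q powi n}" for x
    proof (cases "x \<ge> 0")
      case True
      then have "x \<in> \<Phi> -` cyl n a \<inter> {0..} \<longleftrightarrow> (\<forall>m\<le>n. digit_floor q x m mod q = d (a $$ m))"
        using q2 by (auto simp: cyl_def \<Phi> e_eq)
      also have "\<dots> \<longleftrightarrow> \<lfloor>x * of_int q powi n\<rfloor> = k" using k(2)[OF True] by (simp add: digit_floor_def)
      also have "\<dots> \<longleftrightarrow> of_int k \<le> x * of_int q powi n \<and> x * of_int q powi n < of_int k + 1"
        by linarith
      finally show ?thesis using pos k(1) by (simp add: field_simps)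
    next
      case False
      moreover have "real (nat k) / of_int q powi n \<ge> 0" using pos by simp
      ultimately show ?thesis by (auto simp del: zero_le_divide_iff)
    qed
    then show ?thesis by blast
  qed
  define C where "C = insert {} {cyl n a |n (a :: 'a fls). True}"
  have ex_k: "\<exists>k::nat. cyl n a = cyl n (\<Phi> (k / of_int q powi n))" for n a
  proof -
    obtain k :: nat where k: "\<Phi> -` cyl n a \<inter> {0..} = {real k / of_int q powi n ..< (real k + 1) / of_int q powi n}"
      using pre by blast
    have "k / of_int q powi n \<in> \<Phi> -` cyl n a \<inter> {0..}"
      unfolding k using q2 by (simp add: divide_strict_right_mono)
    then have "\<Phi> (k / of_int q powi n) \<in> cyl n a" by simp
    then have "cyl n a = cyl n (\<Phi> (k / of_int q powi n))" by (auto simp: cyl_def)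
    then show ?thesis ..
  qed
  have "C \<subseteq> insert {} ((\<lambda>(n, k::nat). cyl n (\<Phi> (k / of_int q powi n))) ` UNIV)"
    using ex_k by (fastforce simp: C_def)
  then have countC: "countable C" by (rule countable_subset) (intro countable_insert countable_image, simp)
  have borel_C: "sets (borel :: 'a fls measure) = sigma_sets UNIV C"
  proof
    have "U \<in> sigma_sets UNIV C" if U: "open U" for U :: "'a fls set"
    proof -
      have "U = \<Union>{c \<in> C. c \<subseteq> U}"
      proof (intro equalityI subsetI)
        fix a assume "a \<in> U"
        then obtain n where "cyl n a \<subseteq> U" using cyl_in_open[OF U] by blast
        moreover have "cyl n a \<in> C" unfolding C_def by blast
        ultimately show "a \<in> \<Union>{c \<in> C. c \<subseteq> U}" using cyl_self[of a n] by blast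
      qed auto
      moreover have "\<Union>{c \<in> C. c \<subseteq> U} \<in> sigma_sets UNIV C"
        by (intro sigma_sets_UNION) (auto intro: countable_subset[OF _ countC])
      ultimately show ?thesis by simp
    qed
    then show "sets (borel :: 'a fls measure) \<subseteq> sigma_sets UNIV C"
      unfolding borel_def by (auto intro!: sigma_sets_mono simp: sets_measure_of_conv)
    have "C \<subseteq> sets borel" by (auto simp: C_def cyl_borel)
    then show "sigma_sets UNIV C \<subseteq> sets (borel :: 'a fls measure)"
      using sets.sigma_sets_subset[of C "borel :: 'a fls measure"] by simp
  qed
  define L where "L = restrict_space lborel {0::real..}"
  have spL: "space L = {0..}" by (simp add: L_def space_restrict_space)
  have \<Phi>_meas: "\<Phi> \<in> L \<rightarrow>\<^sub>M borel"
  proof (rule measurable_sigma_sets[OF borel_C])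
    fix c assume "c \<in> C"
    then have "\<Phi> -` c \<inter> {0..} \<in> sets borel"
    proof (cases "c = {}")
      case False
      then obtain n a where c: "c = cyl n a" using \<open>c \<in> C\<close> by (auto simp: C_def)
      obtain k :: nat where "\<Phi> -` cyl n a \<inter> {0..} = {real k / of_int q powi n ..< (real k + 1) / of_int q powi n}"
        using pre by blast
      then show ?thesis by (simp add: c)
    qed simp
    then show "\<Phi> -` c \<inter> space L \<in> sets L"
      by (simp add: spL) (simp add: L_def sets_restrict_space_iff)
  qed auto
  define M where "M = distr L borel \<Phi>"
  have M_sets: "sets M = sets borel" by (simp add: M_def)
  have M_cyl: "emeasure M (cyl n a) = ennreal (1 / of_int q powi n)" for n a
  proof -
    obtain k :: nat where k: "\<Phi> -` cyl n a \<inter> {0..} = {real k / of_int q powi n ..< (real k + 1) / of_int q powi n}"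
      using pre by blast
    have "emeasure M (cyl n a) = emeasure L (\<Phi> -` cyl n a \<inter> {0..})"
      unfolding M_def using \<Phi>_meas by (simp add: emeasure_distr spL cyl_borel)
    also have "\<dots> = emeasure lborel (\<Phi> -` cyl n a \<inter> {0..})"
      unfolding L_def by (intro emeasure_restrict_space) auto
    also have "\<dots> = ennreal (1 / of_int q powi n)"
      unfolding k using q2 by (subst emeasure_lborel_Ico) (auto simp: diff_divide_distrib[symmetric] divide_right_mono)
    finally show ?thesis .
  qed
  have cover: "(\<Union>n::nat. cyl (- int n) 0) = (UNIV :: 'a fls set)"
  proof -
    have "z \<in> cyl (- int (nat (1 - fls_subdegree z))) 0" for z :: "'a fls"
      by (auto simp: cyl_def intro!: fls_eq0_below_subdegree)
    then show ?thesis by blast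
  qed
  have trans: "emeasure M ((+) a ` A) = emeasure M A" if "A \<in> sets borel" for a A
  proof -
    have "continuous_on UNIV ((+) (- a))"
      by (auto simp: continuous_on_iff dist_fls_powi)
    then have meas: "(+) (- a) \<in> M \<rightarrow>\<^sub>M borel"
      using borel_measurable_continuous_onI measurable_cong_sets[OF M_sets refl] by blast
    have img: "(+) a ` B = (+) (- a) -` B" for B
      by (force simp: image_iff)
    have "M = distr M borel ((+) (- a))"
    proof (rule measure_eqI_generator_eq[where E = C and \<Omega> = UNIV and A = "\<lambda>n. cyl (- int n) 0"])
      show "Int_stable C"
      proof (rule Int_stableI)
        fix c c' assume "c \<in> C" "c' \<in> C"
        then show "c \<inter> c' \<in> C"
        proof (cases "c = {} \<or> c' = {}")
          case False
          then obtain n a m b where "c = cyl n a" "c' = cyl m b"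
            using \<open>c \<in> C\<close> \<open>c' \<in> C\<close> by (auto simp: C_def)
          then show ?thesis
            using cyl_Int[of n m a b] cyl_Int[of m n b a] \<open>c \<in> C\<close> \<open>c' \<in> C\<close>
            by (cases "n \<le> m") (auto simp: Int_commute C_def)
        qed (auto simp: C_def)
      qed
      fix c assume "c \<in> C"
      then consider "c = {}" | n b where "c = cyl n b" by (auto simp: C_def)
      then show "emeasure M c = emeasure (distr M borel ((+) (- a))) c"
      proof cases
        case 2
        have "(+) (- a) -` cyl n b = cyl n (a + b)"
          by (auto simp: cyl_def algebra_simps)
        moreover have "space M = UNIV" using sets_eq_imp_space_eq[OF M_sets] by simp
        ultimately show ?thesis
          unfolding 2 using meas by (simp add: emeasure_distr M_cyl cyl_borel)
      qed simp
    qed (use cover in \<open>auto simp: M_sets borel_C M_cyl C_def\<close>)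
    then have "emeasure M A = emeasure (distr M borel ((+) (- a))) A" by simp
    also have "\<dots> = emeasure M ((+) (- a) -` A)"
      using meas that sets_eq_imp_space_eq[OF M_sets] by (simp add: emeasure_distr)
    finally show ?thesis by (simp add: img)
  qed
  have compact: "emeasure M K < \<infinity>" if K: "compact K" for K
  proof -
    obtain I where I: "finite I" "K \<subseteq> (\<Union>n\<in>I. cyl (- int n) 0)"
      using compactE_image[OF K, of UNIV "\<lambda>n::nat. cyl (- int n) 0"] open_cyl cover
      by (metis subset_UNIV)
    have "emeasure M K \<le> emeasure M (\<Union>n\<in>I. cyl (- int n) 0)"
      using I by (intro emeasure_mono) (auto simp: M_sets cyl_borel)
    also have "\<dots> \<le> (\<Sum>n\<in>I. emeasure M (cyl (- int n) 0))"
      using I by (intro emeasure_subadditive_finite) (auto simp: M_sets cyl_borel)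
    also have "\<dots> < \<infinity>" using I(1) by (auto simp: M_cyl less_top[symmetric])
    finally show ?thesis .
  qed
  have "emeasure M (cyl 0 0) \<le> emeasure M UNIV"
    by (intro emeasure_mono) (auto simp: M_sets)
  then have "emeasure M UNIV \<noteq> 0" by (auto simp: M_cyl)
  then show ?thesis
    unfolding haar_measure_fls_def using M_sets trans compact by blast
qed

end

end

theory Submission
  imports Defs
begin

text \<open>
  Put \<open>\<xi> = x\<^sub>1/x\<^sub>2\<close> and \<open>\<tau> = t/x\<^sub>2\<close>, and let \<open>\<gamma> = (a b; c d)\<close> of size \<open>q\<^sup>n\<close> bring \<open>(\<xi>,1)\<^sup>T\<close> within
  \<open>q\<^sup>-\<^sup>n\<^sup>/\<^sup>2\<close> of \<open>\<tau>(y,1)\<^sup>T\<close>. As \<open>\<omega>(y) = 1\<close>, Dirichlet's theorem and Bezout's identity give a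
  unimodular \<open>h = (Q -P; Q' -P')\<close> of size \<open>q\<^sup>n\<^sup>/\<^sup>4\<close> whose rows are both nearly orthogonal to \<open>(y,1)\<^sup>T\<close>.
  Up to factors \<open>q\<^sup>\<epsilon>\<^sup>n\<close>, the product \<open>h\<gamma>\<close> has size \<open>q\<^sup>3\<^sup>n\<^sup>/\<^sup>4\<close> and maps \<open>(\<xi>,1)\<^sup>T\<close> to a vector of size
  \<open>q\<^sup>-\<^sup>n\<^sup>/\<^sup>4\<close>. The bottom rows of such matrices are well spaced rational approximations of \<open>-\<xi>\<close>, and the top
  rows are determined up to multiples of the bottom row, so there are at most \<open>q\<^sup>n\<^sup>/\<^sup>2\<^sup>+\<^sup>\<epsilon>\<^sup>n\<close> of them.
  For \<open>m > 1/2\<close>, each \<open>\<gamma>\<close> accounts for a ball of measure \<open>q\<^sup>-\<^sup>m\<^sup>n\<close> in \<open>t\<close>, and Borel--Cantelli applies.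
\<close>

unbundle fps_syntax

subsection \<open>The absolute value\<close>

lemma card_field_ge_2: "2 \<le> CARD('a::{field,finite})"
proof -
  have "card {0, 1 :: 'a} \<le> CARD('a)" by (intro card_mono) auto
  then show ?thesis by simp
qed

lemma card_field_gt_Suc_0 [simp]: "Suc 0 < CARD('a::{field,finite})"
  using card_field_ge_2[where 'a='a] by simp

lemma card_field_gt_1: "1 < real CARD('a::{field,finite})"
  using card_field_ge_2[where 'a='a] by simp

lemma fls_abs_0 [simp]: "fls_abs 0 = 0"
  by (simp add: fls_abs_def)

lemma fls_abs_1 [simp]: "fls_abs 1 = 1"
  by (simp add: fls_abs_def)

lemma fls_abs_nonneg [simp]: "0 \<le> fls_abs x"
  by (simp add: fls_abs_def)

lemma fls_abs_eq_0_iff [simp]: "fls_abs x = 0 \<longleftrightarrow> x = 0"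
  by (simp add: fls_abs_def)

lemma fls_abs_pos_iff [simp]: "0 < fls_abs x \<longleftrightarrow> x \<noteq> 0"
  by (simp add: fls_abs_def)

lemma fls_abs_mult: "fls_abs (x * y) = fls_abs x * fls_abs y"
  by (simp add: fls_abs_def flip: power_int_add)

lemma fls_abs_divide: "fls_abs (x / y) = fls_abs x / fls_abs y"
proof (cases "y = 0")
  case False
  then have "fls_abs (x / y) * fls_abs y = fls_abs x"
    by (simp flip: fls_abs_mult)
  with False show ?thesis by (simp add: field_simps)
qed simp

lemma fls_abs_minus [simp]: "fls_abs (- x) = fls_abs x"
  by (simp add: fls_abs_def)

text \<open>Real exponents replace the integer ones of the definition because later bounds involve
  sizes such as q^(n/2), where q is \<open>CARD('a)\<close>.\<close>

lemma fls_abs_eq_powr: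
  fixes x :: "'a::{field,finite} fls"
  assumes "x \<noteq> 0"
  shows "fls_abs x = real CARD('a) powr (- of_int (fls_subdegree x))"
  using assms powr_real_of_int'[of "real CARD('a)" "- fls_subdegree x"] by (simp add: fls_abs_def)

lemma fls_abs_le_powr_iff:
  fixes x :: "'a::{field,finite} fls"
  shows "fls_abs x \<le> real CARD('a) powr u \<longleftrightarrow> x = 0 \<or> - u \<le> of_int (fls_subdegree x)"
  by (cases "x = 0") (auto simp: fls_abs_eq_powr)

text \<open>Translates size into vanishing coefficients, the form used by the pigeonhole and
  counting arguments.\<close>

lemma fls_abs_le_powr_nth:
  fixes x :: "'a::{field,finite} fls"
  shows "fls_abs x \<le> real CARD('a) powr (- of_int n) \<longleftrightarrow> (\<forall>i<n. x $$ i = 0)"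
proof (cases "x = 0")
  case False
  then have "n \<le> fls_subdegree x \<longleftrightarrow> (\<forall>i<n. x $$ i = 0)"
    by (metis fls_eq0_below_subdegree fls_subdegree_geI order.strict_trans2)
  with False show ?thesis by (simp add: fls_abs_le_powr_iff)
qed simp

text \<open>The ultrametric inequality; thanks to it later sums are bounded term by term with no
  loss in constants.\<close>

lemma fls_abs_add_le:
  fixes x y :: "'a::{field,finite} fls"
  shows "fls_abs (x + y) \<le> max (fls_abs x) (fls_abs y)"
proof (cases "x = 0 \<or> y = 0 \<or> x + y = 0")
  case False
  then have "min (fls_subdegree x) (fls_subdegree y) \<le> fls_subdegree (x + y)"
    using fls_plus_subdegree[of x y] by auto
  with False show ?thesis
    by (auto simp: fls_abs_eq_powr le_max_iff_disj min_le_iff_disj)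
qed (auto simp: le_max_iff_disj)

lemma fls_abs_add_leI: "fls_abs x \<le> b \<Longrightarrow> fls_abs y \<le> b \<Longrightarrow> fls_abs (x + y) \<le> b"
  using fls_abs_add_le[of x y] by linarith

lemma fls_abs_diff_leI: "fls_abs x \<le> b \<Longrightarrow> fls_abs y \<le> b \<Longrightarrow> fls_abs (x - y) \<le> b"
  using fls_abs_add_leI[of x b "- y"] by simp

lemma fls_abs_add_lessI: "fls_abs x < b \<Longrightarrow> fls_abs y < b \<Longrightarrow> fls_abs (x + y) < b"
  using fls_abs_add_le[of x y] by linarith

lemma fls_abs_diff_lessI: "fls_abs x < b \<Longrightarrow> fls_abs y < b \<Longrightarrow> fls_abs (x - y) < b"
  using fls_abs_add_lessI[of x b "- y"] by simp

lemma fls_abs_mult_leI: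
  assumes "fls_abs x \<le> a" "fls_abs y \<le> b"
  shows "fls_abs (x * y) \<le> a * b"
  unfolding fls_abs_mult by (intro mult_mono assms order.trans[OF _ assms(1)]) simp_all

lemma fls_abs_mult_powr_leI:
  fixes x y :: "'a::{field,finite} fls"
  assumes "fls_abs x \<le> real CARD('a) powr u" "fls_abs y \<le> real CARD('a) powr v" "u + v \<le> w"
  shows "fls_abs (x * y) \<le> real CARD('a) powr w"
proof -
  have "fls_abs (x * y) \<le> real CARD('a) powr u * real CARD('a) powr v"
    using assms by (intro fls_abs_mult_leI)
  also have "\<dots> \<le> real CARD('a) powr w"
    using assms(3) by (simp flip: powr_add)
  finally show ?thesis .
qed

lemma fls_abs_le_powr_mono:
  fixes x :: "'a::{field,finite} fls"
  assumes "fls_abs x \<le> real CARD('a) powr u" "u \<le> v"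
  shows "fls_abs x \<le> real CARD('a) powr v"
  using assms by (auto simp: fls_abs_le_powr_iff)

subsection \<open>Polynomials in \<open>T\<close>\<close>

lemma polyT_0 [simp]: "polyT 0 = 0"
  by (simp add: polyT_def)

lemma polyT_pCons: "polyT (pCons a p) = fls_const a + fls_X_inv * polyT p"
  by (simp add: polyT_def map_poly_pCons)

lemma polyT_1 [simp]: "polyT 1 = 1"
  by (simp add: one_pCons polyT_pCons)

text \<open>As \<open>fls_X_inv\<close> is T, the coefficient of T^k sits at index -k. The linear
  rules for \<open>polyT\<close> then follow coefficientwise.\<close>

lemma nth_polyT: "polyT p $$ i = (if i \<le> 0 then coeff p (nat (- i)) else 0)"
proof (induction p arbitrary: i rule: pCons_induct)
  case (pCons a p)
  then show ?case
    by (auto simp: polyT_pCons fls_X_inv_times_conv_shift coeff_pCons nat_diff_distrib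
        split: nat.split)
qed simp

lemma polyT_add: "polyT (p + q) = polyT p + polyT q"
  by (rule fls_eqI) (simp add: nth_polyT)

lemma polyT_diff: "polyT (p - q) = polyT p - polyT q"
  by (rule fls_eqI) (simp add: nth_polyT)

lemma polyT_minus: "polyT (- p) = - polyT p"
  by (rule fls_eqI) (simp add: nth_polyT)

lemma polyT_smult: "polyT (smult c p) = fls_const c * polyT p"
  by (rule fls_eqI) (simp add: nth_polyT)

lemma polyT_mult: "polyT (p * q) = polyT p * polyT q"
  by (induction p rule: pCons_induct) (simp_all add: polyT_pCons polyT_add polyT_smult algebra_simps)

lemmas polyT_simps = polyT_add polyT_diff polyT_minus polyT_mult

lemma polyT_eq_0_iff [simp]: "polyT p = 0 \<longleftrightarrow> p = 0"
proof
  assume "polyT p = 0"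
  then have "polyT p $$ (- int n) = 0" for n by simp
  then show "p = 0" by (intro poly_eqI) (simp add: nth_polyT)
qed simp

lemma fls_subdegree_polyT: "p \<noteq> 0 \<Longrightarrow> fls_subdegree (polyT p) = - int (degree p)"
  by (intro fls_subdegree_eqI) (auto simp: nth_polyT coeff_eq_0)

lemma fls_abs_polyT:
  fixes p :: "'a::{field,finite} poly"
  shows "p \<noteq> 0 \<Longrightarrow> fls_abs (polyT p) = real CARD('a) powr real (degree p)"
  by (simp add: fls_abs_eq_powr fls_subdegree_polyT)

lemma fls_abs_polyT_le_iff:
  fixes p :: "'a::{field,finite} poly"
  shows "fls_abs (polyT p) \<le> real CARD('a) powr u \<longleftrightarrow> p = 0 \<or> real (degree p) \<le> u"
  by (cases "p = 0") (simp_all add: fls_abs_polyT)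

lemma fls_abs_polyT_ge_1: "p \<noteq> 0 \<Longrightarrow> 1 \<le> fls_abs (polyT p)"
  by (simp add: fls_abs_polyT ge_one_powr_ge_zero order_less_imp_le)

lemma ex_poly_coeff:
  fixes g :: "nat \<Rightarrow> 'a::comm_monoid_add"
  shows "\<exists>p. degree p \<le> n \<and> (\<forall>i\<le>n. coeff p i = g i)"
proof -
  let ?p = "\<Sum>i\<le>n. monom (g i) i"
  have "coeff ?p j = (if j \<le> n then g j else 0)" for j
    by (simp add: coeff_sum)
  then have "degree ?p \<le> n \<and> (\<forall>i\<le>n. coeff ?p i = g i)"
    by (auto intro: degree_le)
  then show ?thesis by blast
qed

lemma bij_betw_coeff_degree_le:
  "bij_betw (\<lambda>p :: 'a::comm_monoid_add poly. restrict (coeff p) {..n})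
     {p. degree p \<le> n} ({..n} \<rightarrow>\<^sub>E UNIV)"
  (is "bij_betw ?f ?A ?B")
proof (rule bij_betw_imageI)
  show "inj_on ?f ?A"
  proof (intro inj_onI poly_eqI)
    fix p r :: "'a poly" and i
    assume *: "p \<in> ?A" "r \<in> ?A" "?f p = ?f r"
    show "coeff p i = coeff r i"
    proof (cases "i \<le> n")
      case True
      then show ?thesis using fun_cong[OF *(3), of i] by simp
    qed (use * in \<open>auto simp: coeff_eq_0\<close>)
  qed
  show "?f ` ?A = ?B"
  proof (intro equalityI subsetI)
    fix g :: "nat \<Rightarrow> 'a" assume g: "g \<in> ?B"
    obtain p where p: "degree p \<le> n" "\<forall>i\<le>n. coeff p i = g i" using ex_poly_coeff by blast
    have "g = ?f p" using g p(2) by (auto simp: PiE_def extensional_def fun_eq_iff)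
    with p(1) show "g \<in> ?f ` ?A" by blast
  qed (auto simp: PiE_def)
qed

lemma card_degree_le:
  shows "finite {p :: 'a::{field,finite} poly. degree p \<le> n}"
    and "card {p :: 'a::{field,finite} poly. degree p \<le> n} = CARD('a) ^ (n + 1)"
proof -
  have "finite ({..n} \<rightarrow>\<^sub>E (UNIV :: 'a set))" by (intro finite_PiE) simp_all
  then show "finite {p :: 'a poly. degree p \<le> n}"
    using bij_betw_finite[OF bij_betw_coeff_degree_le[of n, where 'a='a]] by blast
  show "card {p :: 'a poly. degree p \<le> n} = CARD('a) ^ (n + 1)"
    using bij_betw_same_card[OF bij_betw_coeff_degree_le[of n, where 'a='a]]
    by (simp add: card_PiE)
qed

subsection \<open>Counting unimodular matrices with two good approximations of the same point\<close>

text \<open>The determinant and the equality of the fractions d/c and d'/c' give that c divides c'.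
  Equal degrees make the quotient constant, and equal leading coefficients make it 1.\<close>

lemma unimodular_bottom_row_eqI:
  fixes a b c d a' b' c' d' :: "'a::field poly"
  assumes 1: "a * d - b * c = 1" and 2: "a' * d' - b' * c' = 1"
    and eq: "d * c' = d' * c" and deg: "degree c = degree c'" and lead: "lead_coeff c = lead_coeff c'"
    and c: "c \<noteq> 0"
  shows "c = c' \<and> d = d'"
proof -
  have "c' = (a * d - b * c) * c'" using 1 by simp
  also have "\<dots> = a * (d * c') - b * c * c'" by (simp add: algebra_simps)
  also have "\<dots> = c * (a * d' - b * c')" unfolding eq by (simp add: algebra_simps)
  finally obtain e where e: "c' = c * e" by blast
  with c deg lead have "c' \<noteq> 0" by (metis leading_coeff_0_iff)
  with e deg c have "degree e = 0" by (metis add_cancel_right_right degree_mult_eq mult_zero_right)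
  then obtain k where k: "e = [:k:]" by (rule degree_eq_zeroE)
  have "lead_coeff c' = lead_coeff c * k" unfolding e k lead_coeff_mult by simp
  with lead c have "k = 1" by (metis leading_coeff_0_iff mult_cancel_left1)
  with e k have "c = c'" by simp
  with eq c show ?thesis by simp
qed

text \<open>The fraction d/c lies within q^-(r+j) of -\<xi>, so the coefficients of d/c + \<xi>
  vanish below index r+j. Distinct fractions with denominators of degree j differ by at least
  q^(-2j), so the coefficients up to 2j determine the fraction. This leaves j + 1 - r free
  coefficients (none if the difference is truncated), and the leading coefficient of c fixes the
  row.\<close>

lemma card_bottom_rows:
  fixes \<xi> :: "'a::{field,finite} fls" and r j :: nat
  defines "B \<equiv> {(c, d). c \<noteq> 0 \<and> degree c = j \<and> (\<exists>a b. a * d - b * c = 1) \<and>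
     fls_abs (polyT c * \<xi> + polyT d) \<le> real CARD('a) powr (- real r)}"
  shows "finite B" and "card B \<le> CARD('a) * CARD('a) ^ (j + 1 - r)"
proof -
  let ?I = "{int r + int j..2 * int j}"
  let ?z = "\<lambda>c d. polyT d / polyT c + \<xi>"
  let ?f = "\<lambda>(c, d). (lead_coeff c, restrict (\<lambda>i. ?z c d $$ i) ?I)"
  have inj: "inj_on ?f B"
  proof (rule inj_onI)
    fix u v assume uvB: "u \<in> B" "v \<in> B" and uv_eq: "?f u = ?f v"
    obtain c d c' d' where uv: "u = (c, d)" "v = (c', d')" by (metis surj_pair)
    from uvB uv_eq have B: "(c, d) \<in> B" "(c', d') \<in> B" and eq: "?f (c, d) = ?f (c', d')"
      unfolding uv .
    have small: "?z c d $$ i = 0" if "(c, d) \<in> B" "i < int r + int j" for c d i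
    proof -
      from that(1) have c: "c \<noteq> 0" "degree c = j"
        and le: "fls_abs (polyT c * \<xi> + polyT d) \<le> real CARD('a) powr (- real r)"
        by (auto simp: B_def)
      have "?z c d = (polyT c * \<xi> + polyT d) / polyT c" using c by (simp add: field_simps)
      then have "fls_abs (?z c d) = fls_abs (polyT c * \<xi> + polyT d) / real CARD('a) powr real j"
        using c by (simp add: fls_abs_divide fls_abs_polyT)
      also have "\<dots> \<le> real CARD('a) powr (- real r) / real CARD('a) powr real j"
        using le by (intro divide_right_mono) simp_all
      also have "\<dots> = real CARD('a) powr (- of_int (int r + int j))"
        by (simp flip: powr_diff)
      finally show ?thesis using that(2) unfolding fls_abs_le_powr_nth by blast
    qed
    have c: "c \<noteq> 0" "c' \<noteq> 0" "degree c = j" "degree c' = j" using B by (auto simp: B_def)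
    have "(?z c d - ?z c' d') $$ i = 0" if "i < 2 * int j + 1" for i
    proof (cases "i < int r + int j")
      case True
      then have "?z c d $$ i = 0" "?z c' d' $$ i = 0" using small B by blast+
      then show ?thesis by (simp only: fls_minus_nth diff_0_right)
    next
      case False
      with that have "i \<in> ?I" by auto
      moreover have "restrict (($$) (?z c d)) ?I = restrict (($$) (?z c' d')) ?I"
        using eq by (simp only: prod.case prod.inject)
      ultimately have "?z c d $$ i = ?z c' d' $$ i" by (metis restrict_apply')
      then show ?thesis by (simp only: fls_minus_nth diff_self)
    qed
    then have "fls_abs (?z c d - ?z c' d') \<le> real CARD('a) powr (- of_int (2 * int j + 1))"
      unfolding fls_abs_le_powr_nth by blast
    \<comment> \<open>Clearing denominators costs q^(2j), so the cross product is a polynomial of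
      absolute value at most 1/q, hence 0.\<close>
    moreover have "polyT (d * c' - d' * c) = (?z c d - ?z c' d') * (polyT c * polyT c')"
      using c by (simp add: polyT_simps field_simps)
    then have "fls_abs (polyT (d * c' - d' * c)) =
        fls_abs (?z c d - ?z c' d') * real CARD('a) powr (2 * real j)"
      using c by (simp add: fls_abs_mult fls_abs_polyT flip: powr_add)
    ultimately have "fls_abs (polyT (d * c' - d' * c)) \<le>
       real CARD('a) powr (- of_int (2 * int j + 1)) * real CARD('a) powr (2 * real j)"
      by (simp add: mult_right_mono)
    also have "\<dots> = real CARD('a) powr (- 1)" by (simp flip: powr_add)
    finally have "d * c' - d' * c = 0" unfolding fls_abs_polyT_le_iff by simp
    moreover obtain a b a' b' where "a * d - b * c = 1" "a' * d' - b' * c' = 1"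
      using B by (auto simp: B_def)
    moreover have "lead_coeff c = lead_coeff c'" using eq by (simp only: prod.case prod.inject)
    ultimately have "c = c' \<and> d = d'"
      using c by (intro unimodular_bottom_row_eqI[of a d b c a' d' b' c']) simp_all
    then show "u = v" by (simp add: uv)
  qed
  have sub: "?f ` B \<subseteq> UNIV \<times> (?I \<rightarrow>\<^sub>E UNIV)" by (auto simp: PiE_def)
  have fin: "finite ((UNIV :: 'a set) \<times> (?I \<rightarrow>\<^sub>E (UNIV :: 'a set)))"
    by (intro finite_cartesian_product finite_PiE) auto
  show "finite B" by (rule inj_on_finite[OF inj sub fin])
  have "card B \<le> card ((UNIV :: 'a set) \<times> (?I \<rightarrow>\<^sub>E (UNIV :: 'a set)))"
    by (rule card_inj_on_le[OF inj sub fin])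
  also have "card ?I = j + 1 - r" by simp
  then have "card ((UNIV :: 'a set) \<times> (?I \<rightarrow>\<^sub>E (UNIV :: 'a set))) = CARD('a) * CARD('a) ^ (j + 1 - r)"
    by (simp add: card_PiE card_cartesian_product)
  finally show "card B \<le> CARD('a) * CARD('a) ^ (j + 1 - r)" .
qed

text \<open>All top rows completing a given bottom row differ from one of them by p (c, d) with a
  polynomial p, so it suffices to bound the degree of p. The bound on a gives degree at most N -
  degree c; the approximation of \<xi> gives N - r when degree c < r.\<close>

lemma card_top_rows:
  fixes \<xi> :: "'a::{field,finite} fls" and r N :: nat and c d :: "'a poly"
  assumes r: "1 \<le> r" "r \<le> N" and c: "c \<noteq> 0" "degree c \<le> N"
    and cd: "fls_abs (polyT c * \<xi> + polyT d) \<le> real CARD('a) powr (- real r)"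
  defines "F \<equiv> {(a, b). a * d - b * c = 1 \<and> degree a \<le> N \<and>
     fls_abs (polyT a * \<xi> + polyT b) \<le> real CARD('a) powr (- real r)}"
  shows "finite F" and "card F \<le> CARD('a) ^ (N - max (degree c) r + 1)"
proof -
  have "finite F \<and> card F \<le> CARD('a) ^ (N - max (degree c) r + 1)"
  proof (cases "F = {}")
    case False
    then obtain a0 b0 where F0: "(a0, b0) \<in> F" by auto
    then have det0: "a0 * d - b0 * c = 1" and deg0: "degree a0 \<le> N"
      and ab0: "fls_abs (polyT a0 * \<xi> + polyT b0) \<le> real CARD('a) powr (- real r)"
      by (auto simp: F_def)
    \<comment> \<open>The multiplier p: if (a, b) - (a0, b0) = p (c, d), then the determinant of
      (a0, b0) and this difference is p, because \<open>det0\<close> has value 1.\<close>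
    let ?k = "\<lambda>(a, b). a0 * (b - b0) - b0 * (a - a0)"
    have k: "a - a0 = ?k (a, b) * c" "b - b0 = ?k (a, b) * d" if "(a, b) \<in> F" for a b
    proof -
      have "a * d - b * c = 1" using that by (auto simp: F_def)
      with det0 have eq: "(a - a0) * d = (b - b0) * c"
        by (simp add: algebra_simps)
      have "?k (a, b) * c = a0 * ((b - b0) * c) - b0 * c * (a - a0)" by (simp add: algebra_simps)
      also have "\<dots> = (a - a0) * (a0 * d - b0 * c)" unfolding eq[symmetric] by (simp add: algebra_simps)
      finally show "a - a0 = ?k (a, b) * c" unfolding det0 by simp
      have "?k (a, b) * d = a0 * d * (b - b0) - b0 * ((a - a0) * d)" by (simp add: algebra_simps)
      also have "\<dots> = (b - b0) * (a0 * d - b0 * c)" unfolding eq by (simp add: algebra_simps)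
      finally show "b - b0 = ?k (a, b) * d" unfolding det0 by simp
    qed
    have inj: "inj_on ?k F"
    proof (rule inj_onI)
      fix u v assume uvF: "u \<in> F" "v \<in> F" and uv_eq: "?k u = ?k v"
      obtain a b a' b' where uv: "u = (a, b)" "v = (a', b')" by (metis surj_pair)
      from uvF uv_eq have *: "(a, b) \<in> F" "(a', b') \<in> F" "?k (a, b) = ?k (a', b')"
        unfolding uv .
      have "a - a0 = a' - a0" "b - b0 = b' - b0" unfolding k[OF *(1)] k[OF *(2)] *(3) by simp_all
      then show "u = v" by (simp add: uv)
    qed
    have sub: "?k ` F \<subseteq> {p. degree p \<le> N - max (degree c) r}"
    proof (rule image_subsetI, clarify)
      fix a b assume ab: "(a, b) \<in> F"
      define p where "p = ?k (a, b)"
      have dega: "degree a \<le> N"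
        and ab1: "fls_abs (polyT a * \<xi> + polyT b) \<le> real CARD('a) powr (- real r)"
        using ab by (auto simp: F_def)
      have "degree p \<le> N - max (degree c) r"
      proof (cases "p = 0")
        case p: False
        have 1: "degree p + degree c \<le> N"
          using degree_diff_le[OF dega deg0] p c(1) degree_mult_eq[of p c]
          unfolding k(1)[OF ab, folded p_def] by simp
        \<comment> \<open>Here c \<open>?w\<close> is smaller than 1, so the determinant identity
          forces a0 \<open>?z\<close> to have size at least 1, that is, \<open>?z\<close> has size
          at least q^-N. But p \<open>?z\<close> is a difference of two values of size at most
          q^-r.\<close>
        have 2: "degree p + r \<le> N" if "degree c < r"
        proof -
          let ?z = "polyT c * \<xi> + polyT d" and ?w = "polyT a0 * \<xi> + polyT b0"
          have "1 = polyT (a0 * d - b0 * c)" unfolding det0 by simp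
          also have "\<dots> = polyT a0 * ?z - polyT c * ?w" by (simp add: polyT_simps algebra_simps)
          finally have one: "1 = polyT a0 * ?z - polyT c * ?w" .
          have "fls_abs (polyT c * ?w) \<le> real CARD('a) powr (- 1)"
            using c(1) that by (intro fls_abs_mult_powr_leI[OF _ ab0, of _ "real (degree c)"])
              (auto simp: fls_abs_polyT_le_iff)
          also have "\<dots> < real CARD('a) powr 0" by (subst powr_less_cancel_iff) auto
          finally have lt: "fls_abs (polyT c * ?w) < 1" by simp
          have ge: "1 \<le> fls_abs (polyT a0 * ?z)"
          proof (rule ccontr)
            assume "\<not> ?thesis"
            then have "fls_abs (polyT a0 * ?z - polyT c * ?w) < 1"
              using lt by (intro fls_abs_diff_lessI) auto
            then show False using one by simp
          qed
          also have "\<dots> \<le> real CARD('a) powr real N * fls_abs ?z"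
            unfolding fls_abs_mult using deg0 by (intro mult_right_mono) (auto simp: fls_abs_polyT_le_iff)
          finally have z: "1 \<le> real CARD('a) powr real N * fls_abs ?z" .
          have "polyT p * ?z = (polyT a * \<xi> + polyT b) - ?w"
            using arg_cong[OF k(1)[OF ab], of polyT] arg_cong[OF k(2)[OF ab], of polyT]
            unfolding p_def[symmetric] by (simp add: polyT_simps algebra_simps)
          then have "fls_abs (polyT p) * fls_abs ?z \<le> real CARD('a) powr (- real r)"
            by (metis fls_abs_mult fls_abs_diff_leI ab1 ab0)
          then have "real CARD('a) powr real N * (fls_abs (polyT p) * fls_abs ?z)
             \<le> real CARD('a) powr real N * real CARD('a) powr (- real r)"
            by (intro mult_left_mono) auto
          moreover have "fls_abs (polyT p) * 1 \<le> fls_abs (polyT p) * (real CARD('a) powr real N * fls_abs ?z)"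
            using z by (intro mult_left_mono) auto
          ultimately have "fls_abs (polyT p) \<le> real CARD('a) powr (real N - real r)"
            by (simp add: powr_add[symmetric] mult_ac)
          with p show ?thesis unfolding fls_abs_polyT_le_iff by linarith
        qed
        from 1 2 show ?thesis by (cases "degree c < r") auto
      qed simp
      then show "degree (a0 * (b - b0) - b0 * (a - a0)) \<le> N - max (degree c) r"
        by (simp add: p_def)
    qed
    show ?thesis
      using inj_on_finite[OF inj sub card_degree_le(1)]
        card_inj_on_le[OF inj sub card_degree_le(1)] card_degree_le(2)[where 'a='a]
      by simp
  qed auto
  then show "finite F" and "card F \<le> CARD('a) ^ (N - max (degree c) r + 1)" by auto
qed

text \<open>A tuple stands for the matrix (a b; c d). The bottom row comes first so that the set
  embeds into a \<open>Sigma\<close> over bottom rows. The degrees of b and d are controlled through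
  the approximations of \<xi>.\<close>

definition approx_SL2 :: "'a::{field,finite} fls \<Rightarrow> nat \<Rightarrow> nat \<Rightarrow>
    (('a poly \<times> 'a poly) \<times> 'a poly \<times> 'a poly) set" where
  "approx_SL2 \<xi> N r = {((c, d), (a, b)). a * d - b * c = 1 \<and> degree a \<le> N \<and> degree c \<le> N \<and>
     fls_abs (polyT a * \<xi> + polyT b) \<le> real CARD('a) powr (- real r) \<and>
     fls_abs (polyT c * \<xi> + polyT d) \<le> real CARD('a) powr (- real r)}"

text \<open>For each degree j of c the counts of bottom rows and of top rows are multiplied; the
  factor N + 1 counts the values of j.\<close>

lemma card_approx_SL2:
  fixes \<xi> :: "'a::{field,finite} fls" and r N :: nat
  assumes r: "1 \<le> r" "r \<le> N"
  shows "finite (approx_SL2 \<xi> N r)"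
    and "card (approx_SL2 \<xi> N r) \<le> (N + 1) * CARD('a) ^ (N - r + 3)"
proof -
  let ?B = "\<lambda>j. {(c, d). c \<noteq> 0 \<and> degree c = j \<and> (\<exists>a b. a * d - b * c = 1) \<and>
     fls_abs (polyT c * \<xi> + polyT d) \<le> real CARD('a) powr (- real r)}"
  let ?F = "\<lambda>(c, d). {(a, b). a * d - b * c = 1 \<and> degree a \<le> N \<and>
     fls_abs (polyT a * \<xi> + polyT b) \<le> real CARD('a) powr (- real r)}"
  let ?S = "\<lambda>j. Sigma (?B j) ?F"
  have sub: "approx_SL2 \<xi> N r \<subseteq> (\<Union>j\<in>{..N}. ?S j)"
  proof clarify
    fix c d a b assume *: "((c, d), (a, b)) \<in> approx_SL2 \<xi> N r"
    \<comment> \<open>If c = 0, then d is a nonzero polynomial of size at most q^-r < 1, which is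
      impossible.\<close>
    have "c \<noteq> 0"
    proof
      assume "c = 0"
      with * have "d \<noteq> 0" "fls_abs (polyT d) \<le> real CARD('a) powr (- real r)"
        by (auto simp: approx_SL2_def)
      with r show False by (simp add: fls_abs_polyT_le_iff)
    qed
    with * show "((c, d), (a, b)) \<in> (\<Union>j\<in>{..N}. ?S j)"
      by (fastforce simp: approx_SL2_def)
  qed
  have S: "finite (?S j) \<and> card (?S j) \<le> CARD('a) ^ (N - r + 3)" if j: "j \<le> N" for j
  proof
    have F: "finite (?F u)" "card (?F u) \<le> CARD('a) ^ (N - max j r + 1)" if "u \<in> ?B j" for u
      using card_top_rows[OF r, of "fst u" \<xi> "snd u"] that j by (auto simp: case_prod_beta)
    show "finite (?S j)" by (intro finite_SigmaI card_bottom_rows(1) F(1))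
    have "card (?S j) = (\<Sum>u\<in>?B j. card (?F u))"
      by (intro card_SigmaI card_bottom_rows(1) ballI F(1))
    also have "\<dots> \<le> card (?B j) * CARD('a) ^ (N - max j r + 1)"
      using sum_bounded_above[of "?B j" "\<lambda>u. card (?F u)", OF F(2)] by simp
    also have "\<dots> \<le> (CARD('a) * CARD('a) ^ (j + 1 - r)) * CARD('a) ^ (N - max j r + 1)"
      by (intro mult_right_mono card_bottom_rows(2)) simp
    also have "\<dots> = CARD('a) ^ ((j + 1 - r) + (N - max j r + 2))"
      by (simp add: power_add)
    \<comment> \<open>For j \<ge> r the dependence on j cancels; for j < r the truncated difference
      j + 1 - r is 0.\<close>
    also have "\<dots> \<le> CARD('a) ^ (N - r + 3)"
      using j r by (intro power_increasing) auto
    finally show "card (?S j) \<le> CARD('a) ^ (N - r + 3)" .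
  qed
  then have fin: "finite (\<Union>j\<in>{..N}. ?S j)" by blast
  with sub show "finite (approx_SL2 \<xi> N r)" by (rule finite_subset)
  have "card (approx_SL2 \<xi> N r) \<le> card (\<Union>j\<in>{..N}. ?S j)" by (rule card_mono[OF fin sub])
  also have "\<dots> \<le> (\<Sum>j\<in>{..N}. card (?S j))" by (rule card_UN_le) simp
  also have "\<dots> \<le> (N + 1) * CARD('a) ^ (N - r + 3)"
    using sum_bounded_above[of "{..N}" "\<lambda>j. card (?S j)"] S by simp
  finally show "card (approx_SL2 \<xi> N r) \<le> (N + 1) * CARD('a) ^ (N - r + 3)" .
qed

subsection \<open>Balls and their Haar measure\<close>

text \<open>The ball of radius q^-n about a, encoded by coefficients so that splitting and nesting
  of balls become statements about indices.\<close>

definition fls_ball :: "'a::{field,finite} fls \<Rightarrow> int \<Rightarrow> 'a fls set" where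
  "fls_ball a n = {z. \<forall>i<n. z $$ i = a $$ i}"

lemma fls_ballD: "z \<in> fls_ball a n \<Longrightarrow> i < n \<Longrightarrow> z $$ i = a $$ i"
  by (simp add: fls_ball_def)

lemma fls_ball_iff_abs: "z \<in> fls_ball a n \<longleftrightarrow> fls_abs (z - a) \<le> real CARD('a) powr (- of_int n)"
  for a z :: "'a::{field,finite} fls"
  unfolding fls_abs_le_powr_nth by (simp add: fls_ball_def)

text \<open>Nonzero distances in the library metric are integer powers of 2, so being at most 2^-n
  means being less than 2^(1-n).\<close>

lemma fls_ball_eq_ball:
  fixes a :: "'a::{field,finite} fls"
  shows "fls_ball a n = ball a (2 powr (1 - of_int n))"
proof -
  have "z \<in> fls_ball a n \<longleftrightarrow> dist a z < 2 powr (1 - of_int n)" for z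
  proof (cases "z = a")
    case False
    then have "dist a z = 2 powr (- of_int (fls_subdegree (a - z)))"
      using powr_real_of_int'[of 2 "- fls_subdegree (a - z)"]
      by (auto simp: dist_fls_def power_int_def power_one_over inverse_eq_divide)
    moreover have "z \<in> fls_ball a n \<longleftrightarrow> n \<le> fls_subdegree (a - z)"
      using False by (simp add: fls_ball_iff_abs fls_abs_le_powr_iff fls_subdegree_minus_sym[of a])
    ultimately show ?thesis by simp linarith
  qed (auto simp: fls_ball_def)
  then show ?thesis by (simp add: set_eq_iff)
qed

lemma open_fls_ball: "open (fls_ball a n)"
  by (simp add: fls_ball_eq_ball)

lemma fls_ball_self [simp]: "a \<in> fls_ball a n"
  by (simp add: fls_ball_def)

lemma fls_ball_eqI: "b \<in> fls_ball a n \<Longrightarrow> fls_ball b n = fls_ball a n"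
  by (auto simp: fls_ball_def)

lemma fls_ball_mono: "m \<le> n \<Longrightarrow> fls_ball a n \<subseteq> fls_ball a m"
  by (auto simp: fls_ball_def)

lemma fls_ball_in_open:
  fixes a :: "'a::{field,finite} fls"
  assumes "open U" "a \<in> U"
  obtains n where "fls_ball a n \<subseteq> U"
proof -
  obtain e where e: "e > 0" "ball a e \<subseteq> U" using assms openE by blast
  obtain n :: int where n: "1 - log 2 e \<le> of_int n" using ex_le_of_int by blast
  have "(2::real) powr (1 - of_int n) \<le> 2 powr (log 2 e)" using n by simp
  also have "\<dots> = e" using e by simp
  finally have "fls_ball a n \<subseteq> ball a e" unfolding fls_ball_eq_ball by (rule subset_ball)
  with e that show ?thesis by blast
qed

text \<open>\<open>fls_shift (- n) (fls_const c)\<close> is the monomial c T^-n; the ball is split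
  by the value of the coefficient at index n.\<close>

lemma fls_ball_split:
  fixes a :: "'a::{field,finite} fls"
  shows "fls_ball a n = (\<Union>c. fls_ball (a + fls_shift (- n) (fls_const c)) (n + 1))"
proof (intro equalityI subsetI)
  fix z assume z: "z \<in> fls_ball a n"
  have "z \<in> fls_ball (a + fls_shift (- n) (fls_const (z $$ n - a $$ n))) (n + 1)"
    using z by (auto simp: fls_ball_def)
  then show "z \<in> (\<Union>c. fls_ball (a + fls_shift (- n) (fls_const c)) (n + 1))" by blast
next
  fix z assume "z \<in> (\<Union>c. fls_ball (a + fls_shift (- n) (fls_const c)) (n + 1))"
  then obtain c where c: "z \<in> fls_ball (a + fls_shift (- n) (fls_const c)) (n + 1)" by blast
  have "z $$ i = a $$ i" if "i < n" for i using fls_ballD[OF c, of i] that by simp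
  then show "z \<in> fls_ball a n" by (simp add: fls_ball_def)
qed

text \<open>A ball without finite subcover contains one of its q sub-balls without finite subcover.
  Iterating gives nested balls with a common point z, and a member of the cover containing z already
  covers one of them. Compactness makes the Haar measure of balls finite.\<close>

lemma compact_fls_ball:
  fixes a :: "'a::{field,finite} fls"
  shows "compact (fls_ball a n)"
  unfolding compact_eq_Heine_Borel
proof (intro allI impI)
  fix \<C> :: "'a fls set set" assume \<C>: "(\<forall>c\<in>\<C>. open c) \<and> fls_ball a n \<subseteq> \<Union>\<C>"
  define cov where "cov S \<longleftrightarrow> (\<exists>D\<subseteq>\<C>. finite D \<and> S \<subseteq> \<Union>D)" for S
  have "cov (fls_ball a n)"
  proof (rule ccontr)
    assume bad: "\<not> cov (fls_ball a n)"
    have step: "\<exists>b. \<not> cov (fls_ball b (n + int (Suc k))) \<and> b \<in> fls_ball u (n + int k)"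
      if u: "\<not> cov (fls_ball u (n + int k))" for u k
    proof (rule ccontr)
      let ?b = "\<lambda>c. u + fls_shift (- (n + int k)) (fls_const c)"
      assume no: "\<not> ?thesis"
      have "?b c \<in> fls_ball u (n + int k)" for c by (auto simp: fls_ball_def)
      with no have "cov (fls_ball (?b c) (n + int (Suc k)))" for c by blast
      then have "\<forall>c. \<exists>D\<subseteq>\<C>. finite D \<and> fls_ball (?b c) (n + int k + 1) \<subseteq> \<Union>D"
        by (simp add: cov_def add_ac)
      then obtain D where D: "\<And>c. D c \<subseteq> \<C>" "\<And>c. finite (D c)"
        "\<And>c. fls_ball (?b c) (n + int k + 1) \<subseteq> \<Union>(D c)"
        by metis
      have "(\<Union>c. D c) \<subseteq> \<C>" using D(1) by blast
      moreover have "finite (\<Union>c. D c)" using D(2) by simp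
      moreover have "fls_ball u (n + int k) \<subseteq> \<Union>(\<Union>c. D c)"
        unfolding fls_ball_split[of u] using D(3) by blast
      ultimately show False using u unfolding cov_def by blast
    qed
    have "\<exists>f. \<forall>k. (\<not> cov (fls_ball (f k) (n + int k)) \<and> (k = 0 \<longrightarrow> f k = a)) \<and>
        f (Suc k) \<in> fls_ball (f k) (n + int k)"
    proof (rule dependent_nat_choice)
      show "\<exists>u. \<not> cov (fls_ball u (n + int 0)) \<and> (0 = 0 \<longrightarrow> u = a)" using bad by simp
    qed (use step in blast)
    then obtain f where f0: "f 0 = a" and f: "\<And>k. \<not> cov (fls_ball (f k) (n + int k))"
      "\<And>k. f (Suc k) \<in> fls_ball (f k) (n + int k)"
      by blast
    have stable: "f (k + l) $$ i = f k $$ i" if "i < n + int k" for k l i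
    proof (induction l)
      case (Suc l)
      with f(2)[of "k + l"] that show ?case by (simp add: fls_ball_def)
    qed simp
    \<comment> \<open>Coefficient i of \<open>f k\<close> no longer changes once k > i - n. Indices
      below both n and the subdegree of a carry 0, as \<open>Abs_fls\<close> requires.\<close>
    define z where "z = Abs_fls (\<lambda>i. f (nat (i - n) + 1) $$ i)"
    have z: "z $$ i = f (nat (i - n) + 1) $$ i" for i
    proof -
      have "f (nat (i - n) + 1) $$ i = 0" if "i < min n (fls_subdegree a)" for i
        using stable[of i 0 "nat (i - n) + 1"] that f0 by simp
      then show ?thesis unfolding z_def
        by (intro nth_Abs_fls_lower_bound[of "min n (fls_subdegree a)"]) blast
    qed
    have z_ball: "z \<in> fls_ball (f k) (n + int k)" for k
    proof -
      have "z $$ i = f k $$ i" if i: "i < n + int k" for i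
      proof (cases "i < n")
        case True
        then show ?thesis using stable[of i 0 "nat (i - n) + 1"] stable[of i 0 k] z[of i] by simp
      next
        case False
        then have "nat (i - n) + 1 \<le> k" using i by linarith
        then obtain l where "k = nat (i - n) + 1 + l" by (metis le_iff_add)
        then show ?thesis using stable[of i "nat (i - n) + 1" l] False z[of i] by simp
      qed
      then show ?thesis by (simp add: fls_ball_def)
    qed
    from z_ball[of 0] f0 \<C> obtain U where U: "U \<in> \<C>" "z \<in> U" by auto
    with \<C> obtain m where m: "fls_ball z m \<subseteq> U" using fls_ball_in_open[of U z] by blast
    have "fls_ball (f (nat (m - n))) (n + int (nat (m - n))) \<subseteq> fls_ball z m"
      unfolding fls_ball_eqI[OF z_ball, symmetric] by (rule fls_ball_mono) simp
    with m U have "cov (fls_ball (f (nat (m - n))) (n + int (nat (m - n))))"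
      unfolding cov_def by (intro exI[of _ "{U}"]) auto
    with f(1) show False by blast
  qed
  then show "\<exists>D\<subseteq>\<C>. finite D \<and> fls_ball a n \<subseteq> \<Union>D" unfolding cov_def .
qed

text \<open>C is the measure of the unit ball. By translation invariance balls of equal radius have
  equal measure, and each ball is the disjoint union of q balls of the next radius.\<close>

lemma haar_fls_ball:
  fixes M :: "'a::{field,finite} fls measure"
  assumes "haar_measure_fls M"
  obtains C where "0 \<le> C" "\<And>a k. emeasure M (fls_ball a (int k)) = ennreal (C / real CARD('a) ^ k)"
proof -
  have sets: "sets M = sets borel"
    and trans: "\<And>A a. A \<in> sets borel \<Longrightarrow> emeasure M ((+) a ` A) = emeasure M A"
    and fin: "\<And>K. compact K \<Longrightarrow> emeasure M K < \<infinity>"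
    using assms by (auto simp: haar_measure_fls_def)
  have ball_sets: "fls_ball a n \<in> sets M" for a n unfolding sets by (intro borel_open open_fls_ball)
  have ball0: "emeasure M (fls_ball a n) = emeasure M (fls_ball 0 n)" for a n
  proof -
    have "fls_ball a n = (+) a ` fls_ball 0 n"
    proof (intro equalityI subsetI)
      fix z assume "z \<in> fls_ball a n"
      then have "z - a \<in> fls_ball 0 n" by (simp add: fls_ball_def)
      then show "z \<in> (+) a ` fls_ball 0 n" by (intro image_eqI[of _ _ "z - a"]) simp_all
    qed (auto simp: fls_ball_def)
    with trans ball_sets sets show ?thesis by simp
  qed
  define C where "C = measure M (fls_ball 0 0)"
  have "0 \<le> C" by (simp add: C_def)
  have eC: "emeasure M (fls_ball 0 0) = ennreal C"
    unfolding C_def using fin[OF compact_fls_ball] by (intro emeasure_eq_ennreal_measure) (simp add: less_top)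
  have q: "real CARD('a) > 0" by simp
  have "emeasure M (fls_ball 0 (int k)) = ennreal (C / real CARD('a) ^ k)" for k
  proof (induction k)
    case (Suc k)
    define b :: "'a \<Rightarrow> 'a fls" where "b c = 0 + fls_shift (- int k) (fls_const c)" for c
    have b_nth: "b c $$ int k = c" for c by (simp add: b_def)
    define B where "B c = fls_ball (b c) (int k + 1)" for c
    have "disjoint_family B"
      unfolding disjoint_family_on_def
    proof (intro ballI impI equals0I)
      fix c d z assume "c \<noteq> d" "z \<in> B c \<inter> B d"
      then have "z $$ int k = b c $$ int k" "z $$ int k = b d $$ int k"
        by (auto simp: B_def dest: fls_ballD)
      with \<open>c \<noteq> d\<close> show False unfolding b_nth by simp
    qed
    moreover have "range B \<subseteq> sets M" using ball_sets by (auto simp: B_def)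
    ultimately have "(\<Sum>c\<in>UNIV. emeasure M (B c)) = emeasure M (\<Union>c. B c)"
      by (intro sum_emeasure) auto
    also have "(\<Union>c. B c) = fls_ball 0 (int k)"
      unfolding B_def b_def fls_ball_split[symmetric] ..
    finally have "(\<Sum>c\<in>UNIV. emeasure M (B c)) = ennreal (C / real CARD('a) ^ k)"
      unfolding Suc.IH .
    then have "of_nat CARD('a) * emeasure M (fls_ball 0 (int k + 1)) = ennreal (C / real CARD('a) ^ k)"
      unfolding B_def ball0[of "b _"] by simp
    then have eq: "ennreal (real CARD('a)) * emeasure M (fls_ball 0 (int k + 1)) = ennreal (C / real CARD('a) ^ k)"
      by (simp add: ennreal_of_nat_eq_real_of_nat)
    have "emeasure M (fls_ball 0 (int k + 1)) = ennreal (measure M (fls_ball 0 (int k + 1)))"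
      using fin[OF compact_fls_ball] by (intro emeasure_eq_ennreal_measure) (simp add: less_top)
    then obtain e where e: "0 \<le> e" "emeasure M (fls_ball 0 (int k + 1)) = ennreal e"
      by (metis measure_nonneg)
    from eq e have "real CARD('a) * e = C / real CARD('a) ^ k"
      by (simp add: C_def flip: ennreal_mult')
    then have "e = C / real CARD('a) ^ Suc k" using q by (simp add: field_simps)
    with e show ?case by (simp add: add.commute)
  qed (simp add: eC)
  then have "emeasure M (fls_ball a (int k)) = ennreal (C / real CARD('a) ^ k)" for a k
    unfolding ball0[of a] .
  with \<open>0 \<le> C\<close> show ?thesis by (rule that)
qed

subsection \<open>Unimodular pairs of approximations of a number with exponent one\<close>

lemma ex_polynomial_part: "\<exists>P. \<forall>i\<le>0. (z - polyT P) $$ i = 0"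
proof -
  let ?n = "nat (- fls_subdegree z)"
  obtain P where P: "degree P \<le> ?n" "\<And>i. i \<le> ?n \<Longrightarrow> coeff P i = z $$ (- int i)"
    using ex_poly_coeff[of ?n "\<lambda>i. z $$ (- int i)"] by blast
  have "(z - polyT P) $$ i = 0" if "i \<le> 0" for i
  proof (cases "nat (- i) \<le> ?n")
    case True
    then show ?thesis using that P(2)[of "nat (- i)"] by (simp add: nth_polyT)
  next
    case False
    then have "i < fls_subdegree z" "degree P < nat (- i)" using that P(1) by auto
    then show ?thesis using that by (simp add: nth_polyT coeff_eq_0)
  qed
  then show ?thesis by blast
qed

text \<open>Pigeonhole: there are q^(s+1) polynomials Q of degree at most s, but only q^s
  possibilities for the coefficients of Qy at the indices 1 to s. The difference of two colliding
  polynomials works.\<close>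

lemma dirichlet_fls:
  fixes y :: "'a::{field,finite} fls"
  shows "\<exists>Q P. Q \<noteq> 0 \<and> degree Q \<le> s \<and> fls_abs (polyT Q * y - polyT P) \<le> real CARD('a) powr (- real (s + 1))"
proof -
  let ?I = "{1..int s}"
  let ?f = "\<lambda>Q :: 'a poly. restrict (\<lambda>i. (polyT Q * y) $$ i) ?I"
  have "\<not> inj_on ?f {Q. degree Q \<le> s}"
  proof
    assume inj: "inj_on ?f {Q. degree Q \<le> s}"
    have "card {Q :: 'a poly. degree Q \<le> s} \<le> card (?I \<rightarrow>\<^sub>E (UNIV :: 'a set))"
    proof (rule card_inj_on_le[OF inj])
      show "finite (?I \<rightarrow>\<^sub>E (UNIV :: 'a set))" by (intro finite_PiE) simp_all
    qed (auto simp: PiE_def)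
    then have "CARD('a) ^ (s + 1) \<le> CARD('a) ^ s"
      by (simp add: card_degree_le card_PiE)
    then show False using power_strict_increasing[of s "s + 1" "CARD('a)"] card_field_gt_Suc_0[where 'a='a] by linarith
  qed
  then obtain Q1 Q2 where Q12: "degree Q1 \<le> s" "degree Q2 \<le> s" "Q1 \<noteq> Q2" "?f Q1 = ?f Q2"
    by (auto simp: inj_on_def)
  define Q where "Q = Q1 - Q2"
  have Q: "Q \<noteq> 0" "degree Q \<le> s" using Q12 by (auto simp: Q_def degree_diff_le)
  have zero: "(polyT Q * y) $$ i = 0" if "1 \<le> i" "i \<le> int s" for i
  proof -
    have "(polyT Q1 * y) $$ i = (polyT Q2 * y) $$ i"
      using fun_cong[OF Q12(4), of i] that by simp
    moreover have "polyT Q * y = polyT Q1 * y - polyT Q2 * y"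
      by (simp add: Q_def polyT_simps algebra_simps)
    ultimately show ?thesis by (simp only: fls_minus_nth diff_self)
  qed
  obtain P where P: "\<And>i. i \<le> 0 \<Longrightarrow> (polyT Q * y - polyT P) $$ i = 0"
    using ex_polynomial_part[of "polyT Q * y"] by blast
  have "(polyT Q * y - polyT P) $$ i = 0" if "i < int (s + 1)" for i
  proof (cases "i \<le> 0")
    case False
    then show ?thesis using zero[of i] that by (simp add: nth_polyT)
  qed (rule P)
  then have "fls_abs (polyT Q * y - polyT P) \<le> real CARD('a) powr (- of_int (int (s + 1)))"
    unfolding fls_abs_le_powr_nth by blast
  then show ?thesis using Q by auto
qed

lemma bezout_poly:
  fixes P Q :: "'a::field poly"
  shows "\<exists>g u v. u * P + v * Q = g \<and> g dvd P \<and> g dvd Q"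
proof (induction Q arbitrary: P rule: measure_induct_rule[where f = euclidean_size])
  case (less Q)
  show ?case
  proof (cases "Q = 0")
    case True
    then have "1 * P + 0 * Q = P \<and> P dvd P \<and> P dvd Q" by simp
    then show ?thesis by blast
  next
    case False
    then obtain g u v where g: "u * Q + v * (P mod Q) = g" "g dvd Q" "g dvd P mod Q"
      using less[of "P mod Q" Q] mod_size_less[OF False] by blast
    have "g dvd P" using g(2,3) by (simp add: dvd_mod_iff)
    moreover have "v * P + (u - v * (P div Q)) * Q = g"
      unfolding g(1)[symmetric] by (simp add: minus_div_mult_eq_mod[symmetric] algebra_simps)
    ultimately show ?thesis using g(2) by blast
  qed
qed

text \<open>Cancelling the common factor g of a Dirichlet pair only improves the approximation, as g
  has size at least 1. Bezout then completes the coprime pair to a unimodular matrix, and reduction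
  modulo Q makes Q' smaller than Q unless Q is constant.\<close>

lemma coprime_dirichlet_fls:
  fixes y :: "'a::{field,finite} fls"
  obtains Q P Q' P' where "Q \<noteq> 0" "degree Q \<le> s" "Q' * P - Q * P' = 1"
    "degree Q' < degree Q \<or> degree Q = 0"
    "fls_abs (polyT Q * y - polyT P) \<le> real CARD('a) powr (- real (s + 1))"
proof -
  obtain Q0 P0 where 0: "Q0 \<noteq> 0" "degree Q0 \<le> s"
    "fls_abs (polyT Q0 * y - polyT P0) \<le> real CARD('a) powr (- real (s + 1))"
    using dirichlet_fls by blast
  obtain g u v where g: "u * P0 + v * Q0 = g" "g dvd P0" "g dvd Q0" using bezout_poly by blast
  from g obtain P Q where PQ: "P0 = g * P" "Q0 = g * Q" by (auto simp: dvd_def)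
  with 0 have ne: "g \<noteq> 0" "Q \<noteq> 0" by auto
  have "g * (u * P + v * Q) = g * 1" using g(1) unfolding PQ by (simp add: algebra_simps)
  with ne have one: "u * P + v * Q = 1" by (metis mult_left_cancel)
  have degQ: "degree Q \<le> s" using 0(2) ne unfolding PQ by (simp add: degree_mult_eq)
  have "polyT Q0 * y - polyT P0 = polyT g * (polyT Q * y - polyT P)"
    unfolding PQ by (simp add: polyT_simps algebra_simps)
  then have "fls_abs (polyT Q0 * y - polyT P0) = fls_abs (polyT g) * fls_abs (polyT Q * y - polyT P)"
    by (simp add: fls_abs_mult)
  moreover have "1 * fls_abs (polyT Q * y - polyT P) \<le> fls_abs (polyT g) * fls_abs (polyT Q * y - polyT P)"
    using fls_abs_polyT_ge_1[OF ne(1)] by (intro mult_right_mono) auto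
  ultimately have small: "fls_abs (polyT Q * y - polyT P) \<le> real CARD('a) powr (- real (s + 1))"
    using 0(3) by linarith
  \<comment> \<open>With m and e the remainder and quotient of u by Q, replacing u by m is
    compensated by adding e P to v.\<close>
  have eq: "m * P - Q * (- v - e * P) = (e * Q + m) * P + v * Q" for m e
    by (simp add: algebra_simps)
  have "(u mod Q) * P - Q * (- v - (u div Q) * P) = (u div Q * Q + u mod Q) * P + v * Q"
    using eq .
  also have "\<dots> = 1" unfolding div_mult_mod_eq one ..
  finally have det: "(u mod Q) * P - Q * (- v - (u div Q) * P) = 1" .
  have "degree (u mod Q) < degree Q \<or> degree Q = 0"
    using degree_mod_less[OF ne(2), of u] by auto
  with that[OF ne(2) degQ det _ small] show ?thesis by blast
qed

lemma omega_exp_less: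
  fixes y :: "'a::{field,finite} fls"
  assumes "omega_exp y < ereal w"
  shows "\<forall>\<^sub>F H in at_top. \<forall>Q. Q \<noteq> 0 \<longrightarrow> fls_abs (polyT Q) \<le> H \<longrightarrow> H powr (- w) < dist_polyT (polyT Q * y)"
proof -
  have "ereal w \<notin> {ereal w | w. \<exists>\<^sub>F H in at_top. \<exists>Q. Q \<noteq> 0 \<and>
     fls_abs (polyT Q) \<le> H \<and> dist_polyT (polyT Q * y) \<le> H powr (- w)}"
    using assms unfolding omega_exp_def by (meson Sup_upper linorder_not_le)
  then have "\<not> (\<exists>\<^sub>F H in at_top. \<exists>Q. Q \<noteq> 0 \<and>
     fls_abs (polyT Q) \<le> H \<and> dist_polyT (polyT Q * y) \<le> H powr (- w))" by auto
  then show ?thesis unfolding not_frequently by (rule eventually_mono) force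
qed

lemma dist_polyT_le: "dist_polyT x \<le> fls_abs (x - polyT p)"
  unfolding dist_polyT_def by (rule cINF_lower) (auto intro: bdd_belowI2[of _ 0])

text \<open>As w exceeds the exponent of y, a Dirichlet denominator Q cannot be much smaller than
  q^s: its size exceeds q^(s/w). The determinant gives Q'y - P' = (Q'/Q)(Qy - P) + 1/Q, so the
  second row approximates y nearly as well.\<close>

lemma unimodular_dirichlet:
  fixes y :: "'a::{field,finite} fls"
  assumes "omega_exp y < ereal w" and w: "1 \<le> w"
  shows "\<forall>\<^sub>F s in sequentially. \<exists>Q P Q' P'. Q' * P - Q * P' = 1 \<and> degree Q \<le> s \<and> degree Q' \<le> s \<and>
     fls_abs (polyT Q * y - polyT P) \<le> real CARD('a) powr (- (real s / w)) \<and>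
     fls_abs (polyT Q' * y - polyT P') \<le> real CARD('a) powr (- (real s / w))"
proof -
  let ?q = "real CARD('a)"
  obtain H0 where H0: "\<And>H Q. H0 \<le> H \<Longrightarrow> Q \<noteq> 0 \<Longrightarrow> fls_abs (polyT Q) \<le> H \<Longrightarrow>
      H powr (- w) < dist_polyT (polyT Q * y)"
    using omega_exp_less[OF assms(1)] unfolding eventually_at_top_linorder by blast
  \<comment> \<open>Chosen so that q^(s/w) \<ge> H0 for s \<ge> s0; the maximum with 1 keeps the
    logarithm meaningful.\<close>
  define s0 where "s0 = nat \<lceil>w * log ?q (max 1 H0)\<rceil>"
  have "\<exists>Q P Q' P'. Q' * P - Q * P' = 1 \<and> degree Q \<le> s \<and> degree Q' \<le> s \<and>
     fls_abs (polyT Q * y - polyT P) \<le> ?q powr (- (real s / w)) \<and>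
     fls_abs (polyT Q' * y - polyT P') \<le> ?q powr (- (real s / w))" if s: "s0 \<le> s" for s
  proof -
    have "w * log ?q (max 1 H0) \<le> real s" using s unfolding s0_def by linarith
    then have "log ?q (max 1 H0) \<le> real s / w" using w by (simp add: field_simps)
    then have "?q powr log ?q (max 1 H0) \<le> ?q powr (real s / w)" by simp
    then have "max 1 H0 \<le> ?q powr (real s / w)" by (subst (asm) powr_log_cancel) (simp_all add: card_field_gt_1 less_imp_neq[OF card_field_gt_Suc_0, symmetric])
    then have H: "H0 \<le> ?q powr (real s / w)" by simp
    obtain Q P Q' P' where Q: "Q \<noteq> 0" "degree Q \<le> s" and det: "Q' * P - Q * P' = 1"
      and Q': "degree Q' < degree Q \<or> degree Q = 0"
      and QP: "fls_abs (polyT Q * y - polyT P) \<le> ?q powr (- real (s + 1))"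
      by (rule coprime_dirichlet_fls)
    \<comment> \<open>Otherwise H = q^(s/w) is admissible in \<open>H0\<close>, and its lower bound
      H^-w = q^-s contradicts the Dirichlet bound.\<close>
    have large: "?q powr (real s / w) < fls_abs (polyT Q)"
    proof (rule ccontr)
      assume "\<not> ?thesis"
      then have "(?q powr (real s / w)) powr (- w) < dist_polyT (polyT Q * y)"
        using H0[OF H Q(1)] by simp
      also have "\<dots> \<le> ?q powr (- real (s + 1))" using dist_polyT_le QP by (rule order.trans)
      also have "\<dots> \<le> ?q powr (- real s)" by simp
      finally show False using w by (simp add: powr_powr)
    qed
    moreover have "1 \<le> ?q powr (real s / w)"
      using w by (intro ge_one_powr_ge_zero) (auto simp: order_less_imp_le card_field_gt_1)
    ultimately have "0 < degree Q" using Q by (cases "degree Q = 0") (auto simp: fls_abs_polyT)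
    with Q' have Q': "degree Q' < degree Q" by simp
    have sw: "real s / w \<le> real s" using w mult_right_mono[of 1 w "real s"] by (simp add: field_simps)
    have QP2: "fls_abs (polyT Q * y - polyT P) \<le> ?q powr (- (real s / w))"
      using QP by (rule fls_abs_le_powr_mono) (use sw in simp)
    have "polyT Q' * y - polyT P' =
        (polyT Q' / polyT Q) * (polyT Q * y - polyT P) + polyT (Q' * P - Q * P') / polyT Q"
      using Q by (simp add: polyT_simps field_simps)
    also have "fls_abs \<dots> \<le> ?q powr (- (real s / w))"
    proof (rule fls_abs_add_leI)
      have "fls_abs (polyT Q' / polyT Q) \<le> 1"
        using Q Q' by (cases "Q' = 0") (auto simp: fls_abs_divide fls_abs_polyT)
      then show "fls_abs (polyT Q' / polyT Q * (polyT Q * y - polyT P)) \<le> ?q powr (- (real s / w))"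
        using fls_abs_mult_leI[OF _ QP2] by fastforce
      have "fls_abs (polyT (Q' * P - Q * P') / polyT Q) = inverse (fls_abs (polyT Q))"
        unfolding det by (simp add: fls_abs_divide inverse_eq_divide)
      also have "\<dots> \<le> inverse (?q powr (real s / w))"
        using large by (intro le_imp_inverse_le) auto
      finally show "fls_abs (polyT (Q' * P - Q * P') / polyT Q) \<le> ?q powr (- (real s / w))"
        by (simp add: powr_minus)
    qed
    finally have "fls_abs (polyT Q' * y - polyT P') \<le> ?q powr (- (real s / w))" .
    moreover have "degree Q' \<le> s" using Q(2) Q' by simp
    ultimately show ?thesis using Q(2) det QP2 by blast
  qed
  then show ?thesis unfolding eventually_sequentially by blast
qed

subsection \<open>Counting the matrices that move a point close to a line\<close>

text \<open>
  Since \<open>\<gamma>(\<xi>,1)\<^sup>T\<close> is close to \<open>\<tau>(y,1)\<^sup>T\<close>, the determinant equation forces \<open>a - yc\<close> to be small;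
  so replacing \<open>(a,c)\<close> by \<open>Qa - Pc = Q(a - yc) + (Qy - P)c\<close> reduces the size of the matrix.
\<close>

lemma reduced_row:
  fixes \<xi> y \<tau> :: "'a::{field,finite} fls" and a b c d Q P :: "'a poly" and n s :: nat and K u v :: real
  defines "q \<equiv> real CARD('a)"
  assumes det: "a * d - b * c = 1" and deg: "degree a \<le> n" "degree c \<le> n"
    and K: "0 \<le> K" "fls_abs y \<le> q powr K" "q powr (- K) \<le> fls_abs \<tau>" "fls_abs \<tau> \<le> q powr K"
    and v: "0 \<le> v" "v \<le> real n"
    and e1: "fls_abs (polyT a * \<xi> + polyT b - \<tau> * y) \<le> q powr (K - v)"
    and e2: "fls_abs (polyT c * \<xi> + polyT d - \<tau>) \<le> q powr (K - v)"
    and Q: "degree Q \<le> s" and QP: "fls_abs (polyT Q * y - polyT P) \<le> q powr (- u)"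
  shows "fls_abs (polyT (Q * a - P * c)) \<le> q powr (max (s + 2 * K + (n - v)) (n - u))"
    and "fls_abs (polyT (Q * a - P * c) * \<xi> + polyT (Q * b - P * d)) \<le> q powr (max (K - u) (s + 2 * K - v))"
proof -
  let ?e1 = "polyT a * \<xi> + polyT b - \<tau> * y" and ?e = "polyT c * \<xi> + polyT d - \<tau>"
  have polys: "fls_abs (polyT a) \<le> q powr n" "fls_abs (polyT c) \<le> q powr n" "fls_abs (polyT Q) \<le> q powr s"
    using deg Q by (auto simp: q_def fls_abs_polyT_le_iff)
  \<comment> \<open>Expressing b and d through \<open>?e1\<close> and \<open>?e\<close> cancels
    \<xi> from the determinant.\<close>
  have "1 = polyT (a * d - b * c)" unfolding det by simp
  then have "\<tau> * (polyT a - y * polyT c) = 1 - polyT a * ?e + polyT c * ?e1"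
    by (simp add: polyT_simps algebra_simps)
  also have "fls_abs \<dots> \<le> q powr (K + (n - v))"
  proof (intro fls_abs_add_leI fls_abs_diff_leI)
    have "q powr 0 \<le> q powr (K + (n - v))" unfolding q_def using K(1) v by (subst powr_le_cancel_iff) auto
    then show "fls_abs 1 \<le> q powr (K + (n - v))" by (simp add: q_def)
    show "fls_abs (polyT a * ?e) \<le> q powr (K + (n - v))"
      using polys(1) e2 unfolding q_def by (rule fls_abs_mult_powr_leI) simp
    show "fls_abs (polyT c * ?e1) \<le> q powr (K + (n - v))"
      using polys(2) e1 unfolding q_def by (rule fls_abs_mult_powr_leI) simp
  qed
  finally have "fls_abs \<tau> * fls_abs (polyT a - y * polyT c) \<le> q powr (K + (n - v))"
    by (simp add: fls_abs_mult)
  moreover have "q powr (- K) * fls_abs (polyT a - y * polyT c) \<le> fls_abs \<tau> * fls_abs (polyT a - y * polyT c)"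
    using K(3) by (rule mult_right_mono) simp
  ultimately have "q powr (- K) * fls_abs (polyT a - y * polyT c) \<le> q powr (K + (n - v))" by linarith
  then have "q powr K * (q powr (- K) * fls_abs (polyT a - y * polyT c)) \<le> q powr K * q powr (K + (n - v))"
    by (rule mult_left_mono) simp
  then have ayc: "fls_abs (polyT a - y * polyT c) \<le> q powr (2 * K + (n - v))"
    by (simp add: q_def mult.assoc[symmetric] flip: powr_add)
  have "polyT (Q * a - P * c) = polyT Q * (polyT a - y * polyT c) + (polyT Q * y - polyT P) * polyT c"
    by (simp add: polyT_simps algebra_simps)
  also have "fls_abs \<dots> \<le> q powr (max (s + 2 * K + (n - v)) (n - u))"
  proof (rule fls_abs_add_leI)
    show "fls_abs (polyT Q * (polyT a - y * polyT c)) \<le> q powr (max (s + 2 * K + (n - v)) (n - u))"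
      using polys(3) ayc unfolding q_def by (rule fls_abs_mult_powr_leI) simp
    show "fls_abs ((polyT Q * y - polyT P) * polyT c) \<le> q powr (max (s + 2 * K + (n - v)) (n - u))"
      using QP polys(2) unfolding q_def by (rule fls_abs_mult_powr_leI) simp
  qed
  finally show "fls_abs (polyT (Q * a - P * c)) \<le> q powr (max (s + 2 * K + (n - v)) (n - u))" .
  have e2K: "fls_abs ?e \<le> q powr K"
    using e2 unfolding q_def by (rule fls_abs_le_powr_mono) (use v in simp)
  have ye: "fls_abs (?e1 - y * ?e) \<le> q powr (2 * K - v)"
  proof (rule fls_abs_diff_leI)
    show "fls_abs ?e1 \<le> q powr (2 * K - v)"
      using e1 unfolding q_def by (rule fls_abs_le_powr_mono) (use K in simp)
    show "fls_abs (y * ?e) \<le> q powr (2 * K - v)"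
      using K(2) e2 unfolding q_def by (rule fls_abs_mult_powr_leI) simp
  qed
  \<comment> \<open>The product P \<open>?e\<close> is absorbed into \<open>?e\<close> (Qy - P), so
    that no bound on P is required.\<close>
  have "polyT (Q * a - P * c) * \<xi> + polyT (Q * b - P * d) =
      (\<tau> + ?e) * (polyT Q * y - polyT P) + polyT Q * (?e1 - y * ?e)"
    by (simp add: polyT_simps algebra_simps)
  also have "fls_abs \<dots> \<le> q powr (max (K - u) (s + 2 * K - v))"
  proof (rule fls_abs_add_leI)
    show "fls_abs ((\<tau> + ?e) * (polyT Q * y - polyT P)) \<le> q powr (max (K - u) (s + 2 * K - v))"
      using fls_abs_add_leI[OF K(4) e2K] QP unfolding q_def by (rule fls_abs_mult_powr_leI) simp
    show "fls_abs (polyT Q * (?e1 - y * ?e)) \<le> q powr (max (K - u) (s + 2 * K - v))"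
      using polys(3) ye unfolding q_def by (rule fls_abs_mult_powr_leI) simp
  qed
  finally show "fls_abs (polyT (Q * a - P * c) * \<xi> + polyT (Q * b - P * d)) \<le>
      q powr (max (K - u) (s + 2 * K - v))" .
qed

text \<open>\<tau> stands for t divided by the second coordinate of the point, and K absorbs all
  constants depending on the point, y and t. The exponent 1/2 is the weakest one needed for the
  count.\<close>

definition near_line :: "'a::{field,finite} fls \<Rightarrow> 'a fls \<Rightarrow> real \<Rightarrow> nat \<Rightarrow>
    (('a poly \<times> 'a poly) \<times> 'a poly \<times> 'a poly) set" where
  "near_line \<xi> y K n = {((c, d), (a, b)). a * d - b * c = 1 \<and> degree a \<le> n \<and> degree c \<le> n \<and>
     (\<exists>\<tau>. real CARD('a) powr (- K) \<le> fls_abs \<tau> \<and> fls_abs \<tau> \<le> real CARD('a) powr K \<and>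
       fls_abs (polyT a * \<xi> + polyT b - \<tau> * y) \<le> real CARD('a) powr (K - n / 2) \<and>
       fls_abs (polyT c * \<xi> + polyT d - \<tau>) \<le> real CARD('a) powr (K - n / 2))}"

text \<open>Left multiplication by a unimodular Dirichlet matrix is injective. Taking s near n/4
  balances both maxima of \<open>reduced_row\<close>: the size drops to about q^(3n/4) while the
  image of (\<xi>, 1) has size about q^(-n/4), so \<open>card_approx_SL2\<close> gives about q^(n/2)
  matrices.\<close>

lemma card_near_line:
  fixes \<xi> y :: "'a::{field,finite} fls" and K \<epsilon> :: real
  assumes om: "omega_exp y = 1" and K: "0 \<le> K" "fls_abs y \<le> real CARD('a) powr K"
    and \<epsilon>: "0 < \<epsilon>" "\<epsilon> \<le> 1 / 8"
  shows "\<forall>\<^sub>F n in sequentially. finite (near_line \<xi> y K n) \<and>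
    real (card (near_line \<xi> y K n)) \<le> (2 * K + 3) * (real n + 1) * real CARD('a) powr (n / 2 + 2 * \<epsilon> * n + 4 * K + 7)"
proof -
  let ?q = "real CARD('a)"
  have "omega_exp y < ereal (1 + \<epsilon>)" using om \<epsilon> by (simp add: one_ereal_def)
  then have "\<forall>\<^sub>F s in sequentially. \<exists>Q P Q' P'. Q' * P - Q * P' = 1 \<and> degree Q \<le> s \<and> degree Q' \<le> s \<and>
     fls_abs (polyT Q * y - polyT P) \<le> ?q powr (- (real s / (1 + \<epsilon>))) \<and>
     fls_abs (polyT Q' * y - polyT P') \<le> ?q powr (- (real s / (1 + \<epsilon>)))"
    by (rule unimodular_dirichlet) (use \<epsilon> in simp)
  then obtain s0 where s0: "\<And>s. s0 \<le> s \<Longrightarrow> \<exists>Q P Q' P'. Q' * P - Q * P' = 1 \<and> degree Q \<le> s \<and> degree Q' \<le> s \<and>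
     fls_abs (polyT Q * y - polyT P) \<le> ?q powr (- (real s / (1 + \<epsilon>))) \<and>
     fls_abs (polyT Q' * y - polyT P') \<le> ?q powr (- (real s / (1 + \<epsilon>)))"
    unfolding eventually_sequentially by blast
  \<comment> \<open>The first condition on n gives s0 \<le> n div 4; the second gives r \<ge> 1,
    because \<open>\<epsilon> \<le> 1 / 8\<close>.\<close>
  have bound: "finite (near_line \<xi> y K n) \<and> real (card (near_line \<xi> y K n)) \<le>
      (2 * K + 3) * (real n + 1) * ?q powr (n / 2 + 2 * \<epsilon> * n + 4 * K + 7)"
    if n: "4 * s0 + 4 \<le> n" "8 * (2 * K + 2) \<le> real n" for n
  proof -
    define s where "s = n div 4"
    \<comment> \<open>The terms \<open>\<epsilon> * n\<close> in N and r absorb the loss from s to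
      u; \<open>2 * K + 1\<close> absorbs the constants of \<open>reduced_row\<close> and the
      rounding of n/4.\<close>
    define N where "N = nat \<lceil>3 * n / 4 + \<epsilon> * n + 2 * K + 1\<rceil>"
    define r where "r = nat \<lfloor>n / 4 - \<epsilon> * n - 2 * K - 1\<rfloor>"
    define u where "u = real s / (1 + \<epsilon>)"
    have "s0 \<le> s" using n by (simp add: s_def)
    with s0 obtain Q P Q' P' where h: "Q' * P - Q * P' = 1" and Q: "degree Q \<le> s" "degree Q' \<le> s"
      "fls_abs (polyT Q * y - polyT P) \<le> ?q powr (- u)"
      "fls_abs (polyT Q' * y - polyT P') \<le> ?q powr (- u)"
      unfolding u_def by blast
    have s: "real s \<le> n / 4" "n / 4 - 1 \<le> real s" unfolding s_def by linarith+
    have \<epsilon>n: "0 \<le> \<epsilon> * n" "\<epsilon> * n \<le> n / 8" using \<epsilon> mult_right_mono[OF \<epsilon>(2), of "real n"] by auto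
    have "real s - \<epsilon> * n \<le> u"
    proof -
      have "\<epsilon> * real s \<le> \<epsilon> * n" using s \<epsilon> by (intro mult_left_mono) auto
      moreover have "0 \<le> \<epsilon> * (\<epsilon> * n)" using \<epsilon> by simp
      moreover have "(real s - \<epsilon> * n) * (1 + \<epsilon>) = real s + \<epsilon> * real s - \<epsilon> * n - \<epsilon> * (\<epsilon> * n)"
        by (simp add: algebra_simps)
      ultimately have "(real s - \<epsilon> * n) * (1 + \<epsilon>) \<le> real s" by linarith
      then show ?thesis unfolding u_def using \<epsilon> by (simp add: pos_le_divide_eq)
    qed
    with s have u: "n / 4 - 1 - \<epsilon> * n \<le> u" by linarith
    have Nr: "1 \<le> r" "r \<le> N" "3 * n / 4 + \<epsilon> * n + 2 * K + 1 \<le> real N" "real r \<le> n / 4 - \<epsilon> * n - 2 * K - 1"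
      "real N \<le> 3 * n / 4 + \<epsilon> * n + 2 * K + 2" "n / 4 - \<epsilon> * n - 2 * K - 2 \<le> real r"
    proof -
      have "1 \<le> n / 4 - \<epsilon> * n - 2 * K - 1" using n(2) \<epsilon>n by (simp add: field_simps)
      then show r: "1 \<le> r" "real r \<le> n / 4 - \<epsilon> * n - 2 * K - 1" "n / 4 - \<epsilon> * n - 2 * K - 2 \<le> real r"
        unfolding r_def by linarith+
      show N: "3 * n / 4 + \<epsilon> * n + 2 * K + 1 \<le> real N" "real N \<le> 3 * n / 4 + \<epsilon> * n + 2 * K + 2"
        unfolding N_def using K \<epsilon>n by linarith+
      show "r \<le> N" using r(2) N(1) K \<epsilon>n by linarith
    qed
    \<comment> \<open>Left multiplication by (Q -P; Q' -P'), of determinant 1;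
      \<open>left_inv\<close> applies the inverse matrix.\<close>
    let ?h = "\<lambda>((c, d), (a, b)). ((Q' * a - P' * c, Q' * b - P' * d), (Q * a - P * c, Q * b - P * d))"
    have left_inv: "(\<lambda>((C, D), (A, B)). ((Q * C - Q' * A, Q * D - Q' * B), (P * C - P' * A, P * D - P' * B))) (?h g) = g"
      for g :: "('a poly \<times> 'a poly) \<times> 'a poly \<times> 'a poly"
    proof -
      have "P * (Q' * a - P' * c) - P' * (Q * a - P * c) = a * (Q' * P - Q * P')"
        "Q * (Q' * a - P' * c) - Q' * (Q * a - P * c) = c * (Q' * P - Q * P')" for a c
        by (simp_all add: algebra_simps)
      then show ?thesis unfolding h by (auto split: prod.splits)
    qed
    then have inj: "inj_on ?h (near_line \<xi> y K n)" by (rule inj_on_inverseI)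
    have sub: "?h ` near_line \<xi> y K n \<subseteq> approx_SL2 \<xi> N r"
    proof (rule image_subsetI)
      fix g assume g: "g \<in> near_line \<xi> y K n"
      obtain a b c d where abcd: "g = ((c, d), (a, b))" by (metis surj_pair)
      from g obtain \<tau> where det: "a * d - b * c = 1" and deg: "degree a \<le> n" "degree c \<le> n"
        and \<tau>: "?q powr (- K) \<le> fls_abs \<tau>" "fls_abs \<tau> \<le> ?q powr K"
        and e: "fls_abs (polyT a * \<xi> + polyT b - \<tau> * y) \<le> ?q powr (K - n / 2)"
          "fls_abs (polyT c * \<xi> + polyT d - \<tau>) \<le> ?q powr (K - n / 2)"
        unfolding near_line_def abcd by blast
      have v: "0 \<le> real n / 2" "real n / 2 \<le> real n" by auto
      have N: "max (s + 2 * K + (n - n / 2)) (n - u) \<le> real N" using u s Nr \<epsilon>n K by linarith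
      have r: "max (K - u) (s + 2 * K - n / 2) \<le> - real r" using u s Nr \<epsilon>n K by linarith
      note row = reduced_row[OF det deg K \<tau> v e]
      have "fls_abs (polyT (Q * a - P * c)) \<le> ?q powr N" "fls_abs (polyT (Q' * a - P' * c)) \<le> ?q powr N"
        using row(1)[OF Q(1,3)] row(1)[OF Q(2,4)] N by (blast intro: fls_abs_le_powr_mono)+
      then have "degree (Q * a - P * c) \<le> N" "degree (Q' * a - P' * c) \<le> N"
        unfolding fls_abs_polyT_le_iff by auto
      moreover have "fls_abs (polyT (Q * a - P * c) * \<xi> + polyT (Q * b - P * d)) \<le> ?q powr (- real r)"
        "fls_abs (polyT (Q' * a - P' * c) * \<xi> + polyT (Q' * b - P' * d)) \<le> ?q powr (- real r)"
        using row(2)[OF Q(1,3)] row(2)[OF Q(2,4)] r by (blast intro: fls_abs_le_powr_mono)+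
      moreover have "(Q * a - P * c) * (Q' * b - P' * d) - (Q * b - P * d) * (Q' * a - P' * c) =
          (a * d - b * c) * (Q' * P - Q * P')"
        by (simp add: algebra_simps)
      then have "(Q * a - P * c) * (Q' * b - P' * d) - (Q * b - P * d) * (Q' * a - P' * c) = 1"
        unfolding det h by simp
      ultimately show "?h g \<in> approx_SL2 \<xi> N r" unfolding abcd approx_SL2_def by (simp only: mem_Collect_eq prod.case)
    qed
    have fin: "finite (approx_SL2 \<xi> N r)" using Nr(1,2) by (rule card_approx_SL2)
    have "card (near_line \<xi> y K n) \<le> card (approx_SL2 \<xi> N r)" by (rule card_inj_on_le[OF inj sub fin])
    also have "\<dots> \<le> (N + 1) * CARD('a) ^ (N - r + 3)" using Nr(1,2) by (rule card_approx_SL2)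
    finally have "real (card (near_line \<xi> y K n)) \<le> real ((N + 1) * CARD('a) ^ (N - r + 3))"
      unfolding of_nat_le_iff .
    also have "\<dots> = (real N + 1) * ?q powr (real N - real r + 3)"
    proof -
      have "real N - real r + 3 = real (N - r + 3)" using Nr(2) by (simp add: of_nat_diff)
      then have "?q powr (real N - real r + 3) = ?q ^ (N - r + 3)"
        by (simp only: powr_realpow of_nat_0_less_iff zero_less_card_finite)
      then show ?thesis by (simp only: of_nat_mult of_nat_power of_nat_add of_nat_1)
    qed
    also have "\<dots> \<le> ((2 * K + 3) * (real n + 1)) * ?q powr (n / 2 + 2 * \<epsilon> * n + 4 * K + 7)"
    proof (rule mult_mono)
      have "0 \<le> 2 * (K * n)" using K by simp
      moreover have "(2 * K + 3) * (real n + 1) = 2 * (K * n) + 2 * K + 3 * n + 3"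
        by (simp add: algebra_simps)
      ultimately show "real N + 1 \<le> (2 * K + 3) * (real n + 1)" using Nr(5) \<epsilon>n(2) by linarith
      \<comment> \<open>Rounding N up and r down leaves N - r at most n/2 + 2 \<epsilon> n + 4 K +
        4.\<close>
      show "?q powr (real N - real r + 3) \<le> ?q powr (n / 2 + 2 * \<epsilon> * n + 4 * K + 7)"
      proof (subst powr_le_cancel_iff)
        show "real N - real r + 3 \<le> n / 2 + 2 * \<epsilon> * n + 4 * K + 7" using Nr(5,6) by linarith
      qed (rule card_field_gt_1)
    qed (use K in auto)
    finally show ?thesis using inj_on_finite[OF inj sub fin] by simp
  qed
  have "\<forall>\<^sub>F n in sequentially. 4 * s0 + 4 \<le> n \<and> 8 * (2 * K + 2) \<le> real n"
    by (intro eventually_conj eventually_ge_at_top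
        eventually_compose_filterlim[OF eventually_ge_at_top filterlim_real_sequentially])
  then show ?thesis by (rule eventually_mono) (use bound in blast)
qed

subsection \<open>The Borel--Cantelli argument\<close>

lemma summable_linear_times_powr:
  fixes q \<delta> :: real
  assumes "1 < q" "0 < \<delta>"
  shows "summable (\<lambda>n. (real n + 1) * q powr (- \<delta> * real n))"
proof -
  define z where "z = q powr (- \<delta>)"
  have "z < q powr 0" unfolding z_def using assms by (intro powr_less_mono) auto
  then have "norm z < 1" using assms by (simp add: z_def)
  then have "summable (\<lambda>n. of_nat (Suc n) * z ^ n)" using geometric_deriv_sums sums_summable by blast
  moreover have "z ^ n = q powr (- \<delta> * real n)" for n
    using assms unfolding z_def by (simp add: powr_powr flip: powr_realpow)
  ultimately show ?thesis by (simp add: add.commute)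
qed

text \<open>The centres are the second coordinates of the images of the point under the matrices.
  The radius exponent is rounded down, which enlarges the balls.\<close>

definition near_line_nbhd :: "'a::{field,finite} fls \<Rightarrow> 'a fls \<Rightarrow> 'a fls \<Rightarrow> real \<Rightarrow> real \<Rightarrow> nat \<Rightarrow> 'a fls set" where
  "near_line_nbhd x\<^sub>2 \<xi> y K m n =
     (\<Union>((c, d), (a, b)) \<in> near_line \<xi> y K n. fls_ball (x\<^sub>2 * (polyT c * \<xi> + polyT d)) (int (nat \<lfloor>m * n\<rfloor>)))"

text \<open>About q^(n/2 + 2 \<epsilon> n) balls of measure about q^(-mn) have summable total
  measure when m > 1/2 + 2 \<epsilon>, so Borel-Cantelli applies.\<close>

lemma AE_eventually_not_near_line:
  fixes x\<^sub>2 \<xi> y :: "'a::{field,finite} fls" and K m :: real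
  assumes M: "haar_measure_fls M" and om: "omega_exp y = 1"
    and K: "0 \<le> K" "fls_abs y \<le> real CARD('a) powr K" and m: "1 / 2 < m"
  shows "AE t in M. \<forall>\<^sub>F n in sequentially. t \<notin> near_line_nbhd x\<^sub>2 \<xi> y K m n"
proof -
  let ?q = "real CARD('a)"
  \<comment> \<open>The bound 1/8 is demanded by \<open>card_near_line\<close>; the other one keeps
    at least half of the gap m - 1/2.\<close>
  define \<epsilon> where "\<epsilon> = min (1 / 8) ((m - 1 / 2) / 4)"
  have \<epsilon>: "0 < \<epsilon>" "\<epsilon> \<le> 1 / 8" "0 < m - 1 / 2 - 2 * \<epsilon>" using m by (auto simp: \<epsilon>_def min_def)
  obtain n0 where n0: "\<And>n. n0 \<le> n \<Longrightarrow> finite (near_line \<xi> y K n)"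
    "\<And>n. n0 \<le> n \<Longrightarrow> real (card (near_line \<xi> y K n)) \<le>
        (2 * K + 3) * (real n + 1) * ?q powr (n / 2 + 2 * \<epsilon> * n + 4 * K + 7)"
    using card_near_line[OF om K \<epsilon>(1,2), of \<xi>] unfolding eventually_sequentially by blast
  obtain C where C: "0 \<le> C" "\<And>a k. emeasure M (fls_ball a (int k)) = ennreal (C / ?q ^ k)"
    using haar_fls_ball[OF M] by blast
  have sets: "sets M = sets borel" using M by (simp add: haar_measure_fls_def)
  \<comment> \<open>Finitely many sets are emptied, since the count is known only from n0 on;
    eventual statements are unaffected.\<close>
  define U where "U n = (if n0 \<le> n then near_line_nbhd x\<^sub>2 \<xi> y K m n else {})" for n
  define \<delta> where "\<delta> = m - 1 / 2 - 2 * \<epsilon>"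
  define D where "D = C * (2 * K + 3) * ?q powr (4 * K + 8)"
  have D: "0 \<le> D" using C(1) K(1) by (simp add: D_def)
  have U: "U n \<in> sets M \<and> emeasure M (U n) \<le> ennreal (D * ((real n + 1) * ?q powr (- \<delta> * real n)))" for n
  proof (cases "n0 \<le> n")
    case True
    let ?G = "near_line \<xi> y K n"
    define k where "k = nat \<lfloor>m * n\<rfloor>"
    define F where "F = (\<lambda>((c, d), (a :: 'a poly, b :: 'a poly)). fls_ball (x\<^sub>2 * (polyT c * \<xi> + polyT d)) (int k))"
    have Un: "U n = (\<Union>g\<in>?G. F g)" using True unfolding U_def near_line_nbhd_def F_def k_def by simp
    have ball_sets: "fls_ball a k \<in> sets M" for a k unfolding sets by (intro borel_open open_fls_ball)
    have F: "F g \<in> sets M" "emeasure M (F g) = ennreal (C / ?q ^ k)" for g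
      unfolding F_def by (auto simp: ball_sets C(2) split: prod.split)
    have "emeasure M (U n) \<le> (\<Sum>g\<in>?G. emeasure M (F g))"
      unfolding Un using n0(1)[OF True] F(1) by (intro emeasure_subadditive_finite) auto
    also have "\<dots> = ennreal (real (card ?G)) * ennreal (C / ?q ^ k)"
      unfolding F(2) by (simp add: ennreal_of_nat_eq_real_of_nat)
    also have "\<dots> = ennreal (real (card ?G) * (C / ?q ^ k))"
      using C(1) by (intro ennreal_mult[symmetric]) auto
    also have "\<dots> \<le> ennreal (D * ((real n + 1) * ?q powr (- \<delta> * real n)))"
    proof (rule ennreal_leI)
      have "m * real n - 1 \<le> real k" unfolding k_def by linarith
      then have "?q powr (m * real n - 1) \<le> ?q powr real k" by simp
      also have "\<dots> = ?q ^ k" by (rule powr_realpow) simp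
      finally have "C / ?q ^ k \<le> C / ?q powr (m * real n - 1)"
        using C(1) by (intro divide_left_mono) auto
      also have "\<dots> = C * ?q powr (1 - m * real n)" by (simp add: powr_diff)
      finally have "real (card ?G) * (C / ?q ^ k) \<le>
          ((2 * K + 3) * (real n + 1) * ?q powr (n / 2 + 2 * \<epsilon> * n + 4 * K + 7)) * (C * ?q powr (1 - m * real n))"
        using n0(2)[OF True] C(1) by (intro mult_mono) auto
      also have "\<dots> = C * (2 * K + 3) * (real n + 1) *
          (?q powr (n / 2 + 2 * \<epsilon> * n + 4 * K + 7) * ?q powr (1 - m * real n))" by simp
      also have "?q powr (n / 2 + 2 * \<epsilon> * n + 4 * K + 7) * ?q powr (1 - m * real n) =
          ?q powr (4 * K + 8) * ?q powr (- \<delta> * real n)"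
        unfolding powr_add[symmetric] \<delta>_def by (simp add: algebra_simps)
      finally show "real (card ?G) * (C / ?q ^ k) \<le> D * ((real n + 1) * ?q powr (- \<delta> * real n))"
        by (simp add: D_def mult_ac)
    qed
    finally show ?thesis unfolding Un using n0(1)[OF True] F(1) by auto
  qed (simp add: U_def)
  have "AE t in M. \<forall>\<^sub>F n in sequentially. t \<in> space M - U n"
  proof (rule borel_cantelli_AE1)
    show "U n \<in> sets M" for n using U by blast
    show "emeasure M (U n) < \<infinity>" for n
      using U[of n] by (metis ennreal_less_top infinity_ennreal_def order.strict_trans1)
    have "summable (\<lambda>n. D * ((real n + 1) * ?q powr (- \<delta> * real n)))"
      by (intro summable_mult summable_linear_times_powr card_field_gt_1) (use \<epsilon>(3) in \<open>simp add: \<delta>_def\<close>)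
    then show "summable (\<lambda>n. measure M (U n))"
    proof (rule summable_comparison_test')
      fix n :: nat
      have "0 \<le> D * ((real n + 1) * ?q powr (- \<delta> * real n))" using D by simp
      with U[of n] show "norm (measure M (U n)) \<le> D * ((real n + 1) * ?q powr (- \<delta> * real n))"
        unfolding measure_def by (simp add: enn2real_leI)
    qed
  qed
  then show ?thesis
  proof (rule AE_mp, intro AE_I2 impI)
    fix t assume "\<forall>\<^sub>F n in sequentially. t \<in> space M - U n"
    with eventually_ge_at_top[of n0] show "\<forall>\<^sub>F n in sequentially. t \<notin> near_line_nbhd x\<^sub>2 \<xi> y K m n"
      by eventually_elim (simp add: U_def)
  qed
qed

text \<open>The point 0 lies in balls of arbitrarily small measure. Discarding t = 0 makes \<tau>
  nonzero, hence bounded below by some q^-K.\<close>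

lemma AE_haar_nonzero:
  fixes M :: "'a::{field,finite} fls measure"
  assumes M: "haar_measure_fls M"
  shows "AE t in M. t \<noteq> 0"
proof -
  have sets: "sets M = sets borel" using M by (simp add: haar_measure_fls_def)
  obtain C where C: "0 \<le> C" "\<And>a k. emeasure M (fls_ball a (int k)) = ennreal (C / real CARD('a) ^ k)"
    using haar_fls_ball[OF M] by blast
  have "emeasure M {0} \<le> ennreal (C / real CARD('a) ^ k)" for k
    unfolding C(2)[of 0 k, symmetric]
    by (intro emeasure_mono) (auto simp: sets intro: borel_open open_fls_ball)
  moreover have "(\<lambda>k. ennreal (C / real CARD('a) ^ k)) \<longlonglongrightarrow> ennreal 0"
    by (intro tendsto_ennrealI LIMSEQ_divide_realpow_zero card_field_gt_1)
  ultimately have "emeasure M {0} \<le> ennreal 0"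
    by (intro LIMSEQ_le_const) auto
  then have "{0} \<in> null_sets M" by (intro null_setsI) (auto simp: sets)
  then show ?thesis by (rule AE_I') auto
qed

subsection \<open>Matrices\<close>

lemma vec_abs_le_iff: "vec_abs v \<le> B \<longleftrightarrow> (\<forall>i. fls_abs (v $ i) \<le> B)"
  unfolding vec_abs_def by (subst Max_le_iff) auto

definition mat_degree :: "'a::zero poly ^ 2 ^ 2 \<Rightarrow> nat" where
  "mat_degree \<gamma> = Max (range (\<lambda>(i, j). degree (\<gamma> $ i $ j)))"

lemma degree_le_mat_degree: "degree (\<gamma> $ i $ j) \<le> mat_degree \<gamma>"
  unfolding mat_degree_def by (rule Max_ge) (auto intro!: image_eqI[of _ _ "(i, j)"])

text \<open>The zero polynomial also has degree 0, so a nonzero entry of maximal degree must be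
  found; if that degree is 0, the determinant provides one.\<close>

lemma mat_abs_SL2_poly:
  fixes \<gamma> :: "'a::{field,finite} poly ^ 2 ^ 2"
  assumes "\<gamma> \<in> SL2_poly"
  shows "mat_abs (mat_polyT \<gamma>) = real CARD('a) powr mat_degree \<gamma>"
proof -
  have "\<exists>i j. \<gamma> $ i $ j \<noteq> 0 \<and> degree (\<gamma> $ i $ j) = mat_degree \<gamma>"
  proof (cases "mat_degree \<gamma> = 0")
    case True
    have "\<exists>i j. \<gamma> $ i $ j \<noteq> 0"
    proof (rule ccontr)
      assume "\<not> ?thesis"
      then have "det \<gamma> = 0" by (simp add: det_2)
      with assms show False by (simp add: SL2_poly_def)
    qed
    with True show ?thesis by (metis degree_le_mat_degree le_zero_eq)
  next
    case False
    have "mat_degree \<gamma> \<in> range (\<lambda>(i, j). degree (\<gamma> $ i $ j))"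
      unfolding mat_degree_def by (rule Max_in) auto
    with False show ?thesis by (force simp: image_iff)
  qed
  then obtain i j where ij: "\<gamma> $ i $ j \<noteq> 0" "degree (\<gamma> $ i $ j) = mat_degree \<gamma>" by blast
  show ?thesis unfolding mat_abs_def
  proof (rule Max_eqI)
    show "real CARD('a) powr mat_degree \<gamma> \<in> range (\<lambda>(i, j). fls_abs (mat_polyT \<gamma> $ i $ j))"
      using ij by (intro image_eqI[of _ _ "(i, j)"]) (auto simp: mat_polyT_def fls_abs_polyT)
  qed (auto simp: mat_polyT_def fls_abs_polyT_le_iff degree_le_mat_degree)
qed

lemma finite_mat_degree_less: "finite {\<gamma> :: 'a::{field,finite} poly ^ 2 ^ 2. mat_degree \<gamma> < n}"
proof (rule inj_on_finite)
  let ?f = "\<lambda>\<gamma> :: 'a poly ^ 2 ^ 2. (\<gamma> $ 1 $ 1, \<gamma> $ 1 $ 2, \<gamma> $ 2 $ 1, \<gamma> $ 2 $ 2)"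
  let ?S = "{p :: 'a poly. degree p \<le> n}"
  show "inj_on ?f {\<gamma>. mat_degree \<gamma> < n}" by (auto simp: inj_on_def vec_eq_iff forall_2)
  have "\<gamma> $ i $ j \<in> ?S" if "mat_degree \<gamma> < n"
    for \<gamma> :: "'a poly ^ 2 ^ 2" and i j
    using degree_le_mat_degree[of \<gamma> i j] that by simp
  then show "?f ` {\<gamma>. mat_degree \<gamma> < n} \<subseteq> ?S \<times> ?S \<times> ?S \<times> ?S" by blast
  show "finite (?S \<times> ?S \<times> ?S \<times> ?S)" by (intro finite_cartesian_product card_degree_le(1))
qed

text \<open>Dividing by the second coordinate normalises the point to (\<xi>, 1) at the cost of a
  factor q^K. The exponent m is weakened to 1/2 for \<open>near_line\<close> but kept for the radius
  of the ball.\<close>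

lemma mem_near_line_nbhd:
  fixes x :: "'a::{field,finite} fls ^ 2" and y t :: "'a fls" and K m :: real
  defines "q \<equiv> real CARD('a)"
  assumes \<gamma>: "\<gamma> \<in> SL2_poly" and x2: "x $ 2 \<noteq> 0" and m: "1 / 2 \<le> m"
    and le: "vec_abs (mat_polyT \<gamma> *v x - t *s vector [y, 1]) \<le> mat_abs (mat_polyT \<gamma>) powr (- m)"
    and K: "1 / fls_abs (x $ 2) \<le> q powr K" "q powr (- K) \<le> fls_abs (t / x $ 2)" "fls_abs (t / x $ 2) \<le> q powr K"
  shows "t \<in> near_line_nbhd (x $ 2) (x $ 1 / x $ 2) y K m (mat_degree \<gamma>)"
proof -
  define n where "n = mat_degree \<gamma>"
  define a b c d where abcd: "a = \<gamma> $ 1 $ 1" "b = \<gamma> $ 1 $ 2" "c = \<gamma> $ 2 $ 1" "d = \<gamma> $ 2 $ 2"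
  define \<xi> where "\<xi> = x $ 1 / x $ 2"
  define \<tau> where "\<tau> = t / x $ 2"
  have det: "a * d - b * c = 1" using \<gamma> by (simp add: SL2_poly_def det_2 abcd)
  have deg: "degree a \<le> n" "degree c \<le> n" unfolding abcd n_def by (rule degree_le_mat_degree)+
  have "mat_abs (mat_polyT \<gamma>) powr (- m) = q powr (- m * n)"
    by (simp add: mat_abs_SL2_poly[OF \<gamma>] n_def q_def powr_powr mult.commute)
  with le have "\<forall>i. fls_abs ((mat_polyT \<gamma> *v x - t *s vector [y, 1]) $ i) \<le> q powr (- m * n)"
    unfolding vec_abs_le_iff by simp
  then have e: "fls_abs (polyT a * x $ 1 + polyT b * x $ 2 - t * y) \<le> q powr (- m * n)"
    "fls_abs (polyT c * x $ 1 + polyT d * x $ 2 - t) \<le> q powr (- m * n)"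
    unfolding forall_2 by (simp_all add: mat_polyT_def matrix_vector_mult_def sum_2 abcd)
  have scale: "fls_abs (z / x $ 2) \<le> q powr (K - n / 2)" if "fls_abs z \<le> q powr (- m * n)" for z
  proof -
    have "fls_abs (z / x $ 2) = fls_abs z * (1 / fls_abs (x $ 2))" by (simp add: fls_abs_divide)
    also have "\<dots> \<le> q powr (- m * n) * q powr K"
      using that K(1) by (intro mult_mono) auto
    also have "\<dots> \<le> q powr (K - n / 2)"
      using mult_right_mono[OF m, of "real n"] unfolding q_def powr_add[symmetric] by simp
    finally show ?thesis .
  qed
  have "(polyT a * x $ 1 + polyT b * x $ 2 - t * y) / x $ 2 = polyT a * \<xi> + polyT b - \<tau> * y"
    "(polyT c * x $ 1 + polyT d * x $ 2 - t) / x $ 2 = polyT c * \<xi> + polyT d - \<tau>"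
    using x2 by (simp_all add: \<xi>_def \<tau>_def field_simps)
  with scale e have "fls_abs (polyT a * \<xi> + polyT b - \<tau> * y) \<le> q powr (K - n / 2)"
    "fls_abs (polyT c * \<xi> + polyT d - \<tau>) \<le> q powr (K - n / 2)" by metis+
  with det deg K(2,3) have mem: "((c, d), (a, b)) \<in> near_line \<xi> y K n"
    unfolding near_line_def \<tau>_def q_def by blast
  have "t - x $ 2 * (polyT c * \<xi> + polyT d) = - (polyT c * x $ 1 + polyT d * x $ 2 - t)"
    using x2 by (simp add: \<xi>_def field_simps)
  then have "fls_abs (t - x $ 2 * (polyT c * \<xi> + polyT d)) \<le> q powr (- m * n)"
    using e(2) by (simp only: fls_abs_minus)
  also have "\<dots> \<le> q powr (- of_int (int (nat \<lfloor>m * n\<rfloor>)))"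
  proof -
    have "0 \<le> m * n" using m by simp
    then have "real (nat \<lfloor>m * n\<rfloor>) \<le> m * n" by linarith
    then show ?thesis by (simp add: q_def)
  qed
  finally have ball: "t \<in> fls_ball (x $ 2 * (polyT c * \<xi> + polyT d)) (int (nat \<lfloor>m * n\<rfloor>))"
    unfolding fls_ball_iff_abs q_def .
  show ?thesis
    unfolding near_line_nbhd_def n_def[symmetric] \<xi>_def[symmetric]
    by (rule UN_I[OF mem]) (simp only: prod.case ball)
qed

lemma ex_powr_ge:
  fixes r :: real
  shows "\<exists>k. \<forall>n\<ge>k. r \<le> real CARD('a::{field,finite}) powr real n"
proof -
  obtain k where k: "r < real CARD('a) ^ k" using real_arch_pow[OF card_field_gt_1] by blast
  have "r \<le> real CARD('a) powr real n" if "k \<le> n" for n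
  proof -
    have "r \<le> real CARD('a) powr real k" using k powr_realpow[of "real CARD('a)" k] by simp
    also have "\<dots> \<le> real CARD('a) powr real n" using that by simp
    finally show ?thesis .
  qed
  then show ?thesis by blast
qed

theorem theorem1p5:
  fixes x :: "'a::{field,finite} fls ^ 2" and y :: "'a fls" and M :: "'a fls measure"
  assumes "haar_measure_fls M"
    and "x $ 2 \<noteq> 0" and "x $ 1 / x $ 2 \<notin> ratT"
    and "y \<notin> ratT" and "omega_exp y = 1"
  shows "AE t in M. mu_exp x (t *s vector [y, 1]) \<le> ereal (1 / 2)"
proof -
  let ?q = "real CARD('a)"
  let ?U = "near_line_nbhd (x $ 2) (x $ 1 / x $ 2) y"
  \<comment> \<open>A sequence decreasing to 1/2: together with the natural numbers k in place of K,
    it leaves only countably many null sets to discard.\<close>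
  let ?m = "\<lambda>j::nat. 1 / 2 + 1 / real (Suc j)"
  have "AE t in M. \<forall>k j. fls_abs y \<le> ?q powr real k \<longrightarrow> (\<forall>\<^sub>F n in sequentially. t \<notin> ?U (real k) (?m j) n)"
    unfolding AE_all_countable
  proof (intro allI)
    fix k j :: nat
    show "AE t in M. fls_abs y \<le> ?q powr real k \<longrightarrow> (\<forall>\<^sub>F n in sequentially. t \<notin> ?U (real k) (?m j) n)"
    proof (cases "fls_abs y \<le> ?q powr real k")
      case True
      have "AE t in M. \<forall>\<^sub>F n in sequentially. t \<notin> ?U (real k) (?m j) n"
        using True by (intro AE_eventually_not_near_line[OF assms(1,5)]) auto
      then show ?thesis by (rule AE_mp) simp
    qed simp
  qed
  with AE_haar_nonzero[OF assms(1)] show ?thesis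
  proof eventually_elim
    case (elim t)
    \<comment> \<open>The bound k depends on t, which is why all k were treated
      simultaneously.\<close>
    obtain k1 k2 k3 k4 where k:
      "\<And>n. k1 \<le> n \<Longrightarrow> fls_abs y \<le> ?q powr real n" "\<And>n. k2 \<le> n \<Longrightarrow> 1 / fls_abs (x $ 2) \<le> ?q powr real n"
      "\<And>n. k3 \<le> n \<Longrightarrow> fls_abs (t / x $ 2) \<le> ?q powr real n" "\<And>n. k4 \<le> n \<Longrightarrow> 1 / fls_abs (t / x $ 2) \<le> ?q powr real n"
      using ex_powr_ge by metis
    define k where "k = max (max k1 k2) (max k3 k4)"
    have K: "fls_abs y \<le> ?q powr real k" "1 / fls_abs (x $ 2) \<le> ?q powr real k"
      "fls_abs (t / x $ 2) \<le> ?q powr real k" "1 / fls_abs (t / x $ 2) \<le> ?q powr real k"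
      by (auto intro!: k simp: k_def)
    have pos: "0 < fls_abs (t / x $ 2)" using elim(1) assms(2) by simp
    have "?q powr (- real k) \<le> fls_abs (t / x $ 2)"
      using K(4) pos by (simp add: powr_minus field_simps)
    note K = K(1-3) this
    show "mu_exp x (t *s vector [y, 1]) \<le> ereal (1 / 2)"
      unfolding mu_exp_def
    proof (rule Sup_least, clarify)
      fix m :: real
      let ?\<Gamma> = "{\<gamma> \<in> SL2_poly. vec_abs (mat_polyT \<gamma> *v x - t *s vector [y, 1]) \<le> mat_abs (mat_polyT \<gamma>) powr (- m)}"
      assume inf: "infinite ?\<Gamma>"
      show "ereal m \<le> ereal (1 / 2)"
      proof (rule ccontr)
        assume "\<not> ?thesis"
        then have "0 < m - 1 / 2" by simp
        then obtain j where j: "1 / real (Suc j) < m - 1 / 2"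
          using reals_Archimedean by (metis inverse_eq_divide)
        from elim(2) K(1) obtain n0 where n0: "\<And>n. n0 \<le> n \<Longrightarrow> t \<notin> ?U (real k) (?m j) n"
          unfolding eventually_sequentially by blast
        \<comment> \<open>A matrix of degree n \<ge> n0 would put t into the n-th neighbourhood;
          only finitely many matrices have smaller degree.\<close>
        have "?\<Gamma> \<subseteq> {\<gamma>. mat_degree \<gamma> < n0}"
        proof (intro subsetI CollectI, rule ccontr)
          fix \<gamma> assume \<gamma>: "\<gamma> \<in> ?\<Gamma>" and ge: "\<not> mat_degree \<gamma> < n0"
          from \<gamma> have SL: "\<gamma> \<in> SL2_poly" by simp
          have "1 \<le> mat_abs (mat_polyT \<gamma>)"
            unfolding mat_abs_SL2_poly[OF SL]
            by (intro ge_one_powr_ge_zero) (auto simp: order_less_imp_le[OF card_field_gt_1])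
          then have "mat_abs (mat_polyT \<gamma>) powr (- m) \<le> mat_abs (mat_polyT \<gamma>) powr (- ?m j)"
            using j by (intro powr_mono) auto
          with \<gamma> have "vec_abs (mat_polyT \<gamma> *v x - t *s vector [y, 1]) \<le> mat_abs (mat_polyT \<gamma>) powr (- ?m j)"
            by simp
          then have "t \<in> ?U (real k) (?m j) (mat_degree \<gamma>)"
            using K by (intro mem_near_line_nbhd[OF SL assms(2)]) auto
          with n0 ge show False by simp
        qed
        with inf finite_mat_degree_less show False using finite_subset by blast
      qed
    qed
  qed
qed

end
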